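(* Let $\Phi$ be a Young function, $K$ a locally compact hypergroup with a right Haar measure $m$, $w$ a weight on $K$, and $\eta:=(a_n)_{n\in\mathbb Z}$ an aperiodic sequence in $Z(K)$. If $w$ is densely $(\eta,\Phi)$-hypercyclic, then for every compact subset $E\subseteq K$ with $m(E)>0$ there exist a sequence $(E_k)_{k=1}^\infty$ of Borel subsets of $E$ and a strictly increasing sequence $(n_k)_{k=1}^\infty\subseteq\mathbb N$ such that $\lim_{k\to\infty}\|\chi_{E\setminus E_k}\|_\Phi=0$ and $$\lim_{k\to\infty}\|v_{n_k}^{-1}|_{E_k}\|_{\sup}=\lim_{k\to\infty}\|h_{n_k}|_{E_k}\|_{\sup}=0,$$ where for all $n\in\mathbb N$ and $x\in K$, $v_n(x):=w(x)\cdot w(xa_1^-)\cdots w(xa_n^-)$, $v_n^{-1}:=1/v_n$, and $h_n(x):=v_n(xa_n)$.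
   Context: **Hypergroups.** $\mathcal M(K)$ is the space of complex Radon measures on a locally compact Hausdorff space $K$, $\delta_x$ the point mass at $x$. A locally compact hypergroup is a non-empty locally compact Hausdorff space $K$ with a bilinear positive-continuous map $(\mu,\nu)\mapsto\mu\ast\nu$ on $\mathcal M(K)\times\mathcal M(K)$ into $\mathcal M(K)$ (convolution; positive-continuous means it maps pairs of non-negative measures to non-negative measures and is continuous on those in the cone topology) and an involutive homeomorphism $x\mapsto x^-$ of $K$ such that: (i) $(\mathcal M(K),+,\ast)$ is an associative algebra; (ii) each $\delta_x\ast\delta_y$ is a compactly supported probability measure; (iii) $(x,y)\mapsto\mathrm{supp}(\delta_x\ast\delta_y)$ is continuous into the space of non-empty compact subsets of $K$ with the Michael topology; (iv) there is $e\in K$ with $\delta_x\ast\delta_e=\delta_e\ast\delta_x=\delta_x$ for all $x$; (v) $e\in\mathrm{supp}(\delta_x\ast\delta_y)$ iff $x=y^-$; (vi) $(\delta_x\ast\delta_y)^-=\delta_{y^-}\ast\delta_{x^-}$, where $\mu^-$ is the image of $\mu$ under the involution. A right Haar measure is a non-zero non-negative Radon measure $m$ with $m\ast\delta_x=m$ for all $x\in K$, i.e. $\int f(y\ast x)\,dm(y)=\int f\,dm$ for $f\in C_c(K)$. For Borel $f$: $f(x\ast y):=\int_K f\,d(\delta_x\ast\delta_y)$ whenever the integral exists. For $A,B\subseteq K$, $A\ast B:=\bigcup_{x\in A,y\in B}\mathrm{supp}(\delta_x\ast\delta_y)$. $\chi_A$ is the characteristic function of $A$. The center is $Z(K):=\{x\in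 K:\delta_x\ast\delta_{x^-}=\delta_{x^-}\ast\delta_x=\delta_e\}$; for $z\in Z(K)$, $x\in K$, the set $\mathrm{supp}(\delta_x\ast\delta_z)$ is a singleton, whose element is written $xz$. **Orlicz spaces.** A Young function is a non-zero convex $\Phi:[0,\infty)\to[0,\infty]$ with $\Phi(0)=0$ and $\lim_{x\to\infty}\Phi(x)=\infty$; its complementary function is $\Psi(y)=\sup\{xy-\Phi(x):x\ge0\}$. It is assumed that $\Psi$ is increasing. $L^\Phi(K)$ is the set of Borel measurable $f:K\to\mathbb C$ with $\int_K\Phi(\alpha|f|)\,dm<\infty$ for some $\alpha>0$ (modulo $m$-a.e. equality), a Banach space under $\|f\|_\Phi:=\sup\{\int_K|fv|\,dm: v \text{ Borel},\ \int_K\Psi(|v|)\,dm\le1\}$. For a function $g$ on $K$ and $A\subseteq K$, $\|g|_A\|_{\sup}:=\sup_{x\in A}|g(x)|$ (equal to $0$ if $A=\varnothing$). **Weights and operators.** A weight on $K$ is a bounded continuous function $w:K\to(0,\infty)$. For a sequence $\eta=(a_n)_{n\in\mathbb Z}$ in $K$ and $n\in\mathbb N$, $\Lambda_n f(x):=w(x)\,w(x\ast a_{-1})\cdots w(x\ast a_{-n})\,f(x\ast a_{-n})$ for $f\in L^\Phi(K)$. **Aperiodic sequence.** $\eta=(a_n)_{n\in\mathbb Z}$ is aperiodic if (1) $a_0=e$ and $a_{-n}=a_n^-$ for all $n\in\mathbb N$; (2) for every compact $E\subseteq K$ with $m(E)>0$ there is $N>0$ such that $E\cap(E\ast\{a_n\})=\varnothing$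 and $E\cap(E\ast\{a_{-n}\})=\varnothing$ for all $n\ge N$. **Hypercyclic weights.** A vector $f\in L^\Phi(K)$ is a hypercyclic vector for $w$ if $\{f,\Lambda_1f,\Lambda_2f,\dots\}$ is dense in $L^\Phi(K)$; $w$ is $(\eta,\Phi)$-hypercyclic if such an $f$ exists, and densely $(\eta,\Phi)$-hypercyclic if moreover the set of hypercyclic vectors is dense in $L^\Phi(K)$. *)

theory Defs
  imports "HOL-Analysis.Analysis"
begin

section \<open>Radon measures on a Hausdorff space\<close>

definition radon_measure :: "'a::t2_space measure \<Rightarrow> bool" where
  "radon_measure m \<longleftrightarrow>
     sets m = sets borel \<and>
     (\<forall>C. compact C \<longrightarrow> emeasure m C < \<infinity>) \<and>
     (\<forall>A\<in>sets borel. emeasure m A = (INF U\<in>{U. open U \<and> A \<subseteq> U}. emeasure m U)) \<and>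
     (\<forall>U. open U \<longrightarrow> emeasure m U = (SUP C\<in>{C. compact C \<and> C \<subseteq> U}. emeasure m C))"

text \<open>A complex measure is a set function on the Borel sets. It is extended by \<open>0\<close> to all other
  sets, so that equality of complex measures is equality of functions.\<close>

definition complex_borel_measure :: "('a::topological_space set \<Rightarrow> complex) \<Rightarrow> bool" where
  "complex_borel_measure \<mu> \<longleftrightarrow>
     (\<forall>A. A \<notin> sets borel \<longrightarrow> \<mu> A = 0) \<and>
     (\<forall>A :: nat \<Rightarrow> 'a set. range A \<subseteq> sets borel \<longrightarrow> disjoint_family A \<longrightarrow>
        (\<lambda>i. \<mu> (A i)) sums \<mu> (\<Union>i. A i))"

definition total_variation :: "('a::topological_space set \<Rightarrow> complex) \<Rightarrow> 'a set \<Rightarrow> ennreal" where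
  "total_variation \<mu> A =
     (SUP P\<in>{P. finite P \<and> disjoint P \<and> P \<subseteq> sets borel \<and> \<Union>P = A}. \<Sum>B\<in>P. ennreal (cmod (\<mu> B)))"

definition complex_radon_measures :: "('a::t2_space set \<Rightarrow> complex) set" where
  "complex_radon_measures =
     {\<mu>. complex_borel_measure \<mu> \<and>
          radon_measure (measure_of UNIV (sets borel) (total_variation \<mu>))}"

definition nonneg_radon_measures :: "('a::t2_space set \<Rightarrow> complex) set" where
  "nonneg_radon_measures = {\<mu> \<in> complex_radon_measures. \<forall>A. \<mu> A \<in> \<real>\<^sub>\<ge>\<^sub>0}"

text \<open>The measure in the sense of HOL-Analysis that belongs to a non-negative \<open>\<mu>\<close>.\<close>

definition to_measure :: "('a::topological_space set \<Rightarrow> complex) \<Rightarrow> 'a measure" where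
  "to_measure \<mu> = measure_of UNIV (sets borel) (\<lambda>A. ennreal (Re (\<mu> A)))"

definition point_mass :: "'a::topological_space \<Rightarrow> 'a set \<Rightarrow> complex" where
  "point_mass x A = (if A \<in> sets borel \<and> x \<in> A then 1 else 0)"

definition supp :: "('a::topological_space set \<Rightarrow> complex) \<Rightarrow> 'a set" where
  "supp \<mu> = {x. \<forall>U. open U \<longrightarrow> x \<in> U \<longrightarrow> total_variation \<mu> U \<noteq> 0}"

definition Cc :: "('a::topological_space \<Rightarrow> 'b::real_normed_vector) set" where
  "Cc = {f. continuous_on UNIV f \<and> compact (closure {x. f x \<noteq> 0})}"

text \<open>The cone topology is the weakest topology on the non-negative measures for which
  \<open>\<mu> \<mapsto> \<integral> f d\<mu>\<close> is continuous for every non-negative \<open>f\<close> in \<open>Cc\<close> and for \<open>f = 1\<close>.\<close>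

definition cone_topology :: "('a::t2_space set \<Rightarrow> complex) topology" where
  "cone_topology = topology_generated_by
     {{\<mu> \<in> nonneg_radon_measures. (LINT x|to_measure \<mu>. f x) \<in> V} | (f :: 'a \<Rightarrow> real) V.
        open V \<and> (f \<in> Cc \<and> (\<forall>x. 0 \<le> f x) \<or> f = (\<lambda>x. 1))}"

definition michael_topology :: "'a::t2_space set topology" where
  "michael_topology = topology_generated_by
     {{C. compact C \<and> C \<noteq> {} \<and> C \<inter> U \<noteq> {} \<and> C \<subseteq> V} | U V. open U \<and> open V}"


section \<open>Hypergroups\<close>

locale hypergroup =
  fixes conv :: "('a::t2_space set \<Rightarrow> complex) \<Rightarrow> ('a set \<Rightarrow> complex) \<Rightarrow> 'a set \<Rightarrow> complex"
    and invol :: "'a \<Rightarrow> 'a"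
    and e :: 'a
  assumes locally_compact: "locally_compact_space (euclidean :: 'a topology)"
    and conv_closed: "\<lbrakk>\<mu> \<in> complex_radon_measures; \<nu> \<in> complex_radon_measures\<rbrakk>
          \<Longrightarrow> conv \<mu> \<nu> \<in> complex_radon_measures"
    and conv_add_left: "\<lbrakk>\<mu> \<in> complex_radon_measures; \<mu>' \<in> complex_radon_measures;
          \<nu> \<in> complex_radon_measures\<rbrakk>
          \<Longrightarrow> conv (\<lambda>A. \<mu> A + \<mu>' A) \<nu> = (\<lambda>A. conv \<mu> \<nu> A + conv \<mu>' \<nu> A)"
    and conv_add_right: "\<lbrakk>\<mu> \<in> complex_radon_measures; \<nu> \<in> complex_radon_measures;
          \<nu>' \<in> complex_radon_measures\<rbrakk>
          \<Longrightarrow> conv \<mu> (\<lambda>A. \<nu> A + \<nu>' A) = (\<lambda>A. conv \<mu> \<nu> A + conv \<mu> \<nu>' A)"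
    and conv_scale_left: "\<lbrakk>\<mu> \<in> complex_radon_measures; \<nu> \<in> complex_radon_measures\<rbrakk>
          \<Longrightarrow> conv (\<lambda>A. c * \<mu> A) \<nu> = (\<lambda>A. c * conv \<mu> \<nu> A)"
    and conv_scale_right: "\<lbrakk>\<mu> \<in> complex_radon_measures; \<nu> \<in> complex_radon_measures\<rbrakk>
          \<Longrightarrow> conv \<mu> (\<lambda>A. c * \<nu> A) = (\<lambda>A. c * conv \<mu> \<nu> A)"
    and conv_nonneg: "\<lbrakk>\<mu> \<in> nonneg_radon_measures; \<nu> \<in> nonneg_radon_measures\<rbrakk>
          \<Longrightarrow> conv \<mu> \<nu> \<in> nonneg_radon_measures"
    and conv_continuous: "continuous_map (prod_topology cone_topology cone_topology) cone_topology
          (\<lambda>(\<mu>, \<nu>). conv \<mu> \<nu>)"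
    and conv_assoc: "\<lbrakk>\<mu> \<in> complex_radon_measures; \<nu> \<in> complex_radon_measures;
          \<rho> \<in> complex_radon_measures\<rbrakk> \<Longrightarrow> conv (conv \<mu> \<nu>) \<rho> = conv \<mu> (conv \<nu> \<rho>)"
    and invol_invol: "invol (invol x) = x"
    and invol_continuous: "continuous_on UNIV invol"
    and point_conv_prob: "conv (point_mass x) (point_mass y) \<in> nonneg_radon_measures"
          "conv (point_mass x) (point_mass y) UNIV = 1"
    and point_conv_compact_supp: "compact (supp (conv (point_mass x) (point_mass y)))"
    and supp_continuous: "continuous_map (euclidean :: ('a \<times> 'a) topology) michael_topology
          (\<lambda>(x, y). supp (conv (point_mass x) (point_mass y)))"
    and unit: "conv (point_mass x) (point_mass e) = point_mass x"
          "conv (point_mass e) (point_mass x) = point_mass x"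
    and unit_in_supp_iff: "e \<in> supp (conv (point_mass x) (point_mass y)) \<longleftrightarrow> x = invol y"
    and invol_conv: "(\<lambda>A. conv (point_mass x) (point_mass y) (invol -` A)) =
          conv (point_mass (invol y)) (point_mass (invol x))"

text \<open>In the following definitions \<open>conv\<close> is the convolution of a hypergroup.
  \<open>hg_eval conv f x y\<close> is \<open>f (x * y)\<close>, the integral of \<open>f\<close> over \<open>\<delta>\<^sub>x * \<delta>\<^sub>y\<close>.\<close>

definition hg_eval ::
  "(('a::t2_space set \<Rightarrow> complex) \<Rightarrow> ('a set \<Rightarrow> complex) \<Rightarrow> 'a set \<Rightarrow> complex) \<Rightarrow>
   ('a \<Rightarrow> 'b::{banach,second_countable_topology}) \<Rightarrow> 'a \<Rightarrow> 'a \<Rightarrow> 'b" where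
  "hg_eval conv f x y = (LINT u|to_measure (conv (point_mass x) (point_mass y)). f u)"

definition hg_set_mult ::
  "(('a::t2_space set \<Rightarrow> complex) \<Rightarrow> ('a set \<Rightarrow> complex) \<Rightarrow> 'a set \<Rightarrow> complex) \<Rightarrow>
   'a set \<Rightarrow> 'a set \<Rightarrow> 'a set" where
  "hg_set_mult conv A B = (\<Union>x\<in>A. \<Union>y\<in>B. supp (conv (point_mass x) (point_mass y)))"

definition hg_center ::
  "(('a::t2_space set \<Rightarrow> complex) \<Rightarrow> ('a set \<Rightarrow> complex) \<Rightarrow> 'a set \<Rightarrow> complex) \<Rightarrow>
   ('a \<Rightarrow> 'a) \<Rightarrow> 'a \<Rightarrow> 'a set" where
  "hg_center conv invol e =
     {x. conv (point_mass x) (point_mass (invol x)) = point_mass e \<and>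
         conv (point_mass (invol x)) (point_mass x) = point_mass e}"

text \<open>The element \<open>xz\<close>, for \<open>z\<close> in the center.\<close>

definition hg_mult ::
  "(('a::t2_space set \<Rightarrow> complex) \<Rightarrow> ('a set \<Rightarrow> complex) \<Rightarrow> 'a set \<Rightarrow> complex) \<Rightarrow>
   'a \<Rightarrow> 'a \<Rightarrow> 'a" where
  "hg_mult conv x z = the_elem (supp (conv (point_mass x) (point_mass z)))"

definition right_haar_measure ::
  "(('a::t2_space set \<Rightarrow> complex) \<Rightarrow> ('a set \<Rightarrow> complex) \<Rightarrow> 'a set \<Rightarrow> complex) \<Rightarrow>
   'a measure \<Rightarrow> bool" where
  "right_haar_measure conv m \<longleftrightarrow>
     radon_measure m \<and> emeasure m UNIV \<noteq> 0 \<and>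
     (\<forall>x. \<forall>f :: 'a \<Rightarrow> complex. f \<in> Cc \<longrightarrow> (LINT y|m. hg_eval conv f y x) = (LINT y|m. f y))"


section \<open>Orlicz spaces\<close>

text \<open>Only the values of a Young function on \<open>{0..}\<close> matter.\<close>

definition young_function :: "(real \<Rightarrow> ennreal) \<Rightarrow> bool" where
  "young_function \<Phi> \<longleftrightarrow>
     (\<exists>x\<ge>0. \<Phi> x \<noteq> 0) \<and>
     (\<forall>x\<ge>0. \<forall>y\<ge>0. \<forall>t\<in>{0..1}.
        \<Phi> (t * x + (1 - t) * y) \<le> ennreal t * \<Phi> x + ennreal (1 - t) * \<Phi> y) \<and>
     \<Phi> 0 = 0 \<and> (\<Phi> \<longlongrightarrow> \<infinity>) at_top"

definition complementary :: "(real \<Rightarrow> ennreal) \<Rightarrow> real \<Rightarrow> ennreal" where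
  "complementary \<Phi> y = e2ennreal (SUP x\<in>{0..}. ereal (x * y) - enn2ereal (\<Phi> x))"

text \<open>The complementary function of a Young function is always nondecreasing. It is constant only
  if \<open>\<Phi>\<close> is infinite on all of \<open>{0<..}\<close>, in which case the Orlicz space is trivial.\<close>

definition increasing_complementary :: "(real \<Rightarrow> ennreal) \<Rightarrow> bool" where
  "increasing_complementary \<Phi> \<longleftrightarrow>
     mono_on {0..} (complementary \<Phi>) \<and> \<not> complementary \<Phi> constant_on {0..}"

text \<open>Functions are not identified modulo null sets: the Orlicz norm is then a seminorm, and
  density is density with respect to this seminorm.\<close>

definition orlicz_space ::
  "(real \<Rightarrow> ennreal) \<Rightarrow> 'a::topological_space measure \<Rightarrow> ('a \<Rightarrow> complex) set" where
  "orlicz_space \<Phi> m =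
     {f \<in> borel_measurable borel. \<exists>\<alpha>>0. (\<integral>\<^sup>+x. \<Phi> (\<alpha> * cmod (f x)) \<partial>m) < \<infinity>}"

definition orlicz_norm ::
  "(real \<Rightarrow> ennreal) \<Rightarrow> 'a::topological_space measure \<Rightarrow> ('a \<Rightarrow> complex) \<Rightarrow> ennreal" where
  "orlicz_norm \<Phi> m f =
     (SUP v\<in>{v \<in> borel_measurable borel. (\<integral>\<^sup>+x. complementary \<Phi> (cmod (v x)) \<partial>m) \<le> 1}.
        \<integral>\<^sup>+x. ennreal (cmod (f x * v x)) \<partial>m)"

definition orlicz_dense ::
  "(real \<Rightarrow> ennreal) \<Rightarrow> 'a::topological_space measure \<Rightarrow> ('a \<Rightarrow> complex) set \<Rightarrow> bool" where
  "orlicz_dense \<Phi> m D \<longleftrightarrow>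
     D \<subseteq> orlicz_space \<Phi> m \<and>
     (\<forall>g\<in>orlicz_space \<Phi> m. \<forall>\<epsilon>>0. \<exists>f\<in>D. orlicz_norm \<Phi> m (\<lambda>x. f x - g x) < \<epsilon>)"


section \<open>Weights, aperiodic sequences, hypercyclicity\<close>

definition hg_weight :: "('a::topological_space \<Rightarrow> real) \<Rightarrow> bool" where
  "hg_weight w \<longleftrightarrow> continuous_on UNIV w \<and> bounded (range w) \<and> (\<forall>x. 0 < w x)"

definition Lambda ::
  "(('a::t2_space set \<Rightarrow> complex) \<Rightarrow> ('a set \<Rightarrow> complex) \<Rightarrow> 'a set \<Rightarrow> complex) \<Rightarrow>
   ('a \<Rightarrow> real) \<Rightarrow> (int \<Rightarrow> 'a) \<Rightarrow> nat \<Rightarrow> ('a \<Rightarrow> complex) \<Rightarrow> 'a \<Rightarrow> complex" where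
  "Lambda conv w a n f x =
     complex_of_real (w x * (\<Prod>j=1..n. hg_eval conv w x (a (- int j)))) *
     hg_eval conv f x (a (- int n))"

definition aperiodic ::
  "(('a::t2_space set \<Rightarrow> complex) \<Rightarrow> ('a set \<Rightarrow> complex) \<Rightarrow> 'a set \<Rightarrow> complex) \<Rightarrow>
   ('a \<Rightarrow> 'a) \<Rightarrow> 'a \<Rightarrow> 'a measure \<Rightarrow> (int \<Rightarrow> 'a) \<Rightarrow> bool" where
  "aperiodic conv invol e m a \<longleftrightarrow>
     a 0 = e \<and> (\<forall>n::nat. a (- int n) = invol (a (int n))) \<and>
     (\<forall>E. compact E \<and> emeasure m E > 0 \<longrightarrow>
        (\<exists>N>0. \<forall>n::nat. n \<ge> N \<longrightarrow>
           E \<inter> hg_set_mult conv E {a (int n)} = {} \<and>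
           E \<inter> hg_set_mult conv E {a (- int n)} = {}))"

definition hypercyclic_vector ::
  "(('a::t2_space set \<Rightarrow> complex) \<Rightarrow> ('a set \<Rightarrow> complex) \<Rightarrow> 'a set \<Rightarrow> complex) \<Rightarrow>
   'a measure \<Rightarrow> (int \<Rightarrow> 'a) \<Rightarrow> (real \<Rightarrow> ennreal) \<Rightarrow> ('a \<Rightarrow> real) \<Rightarrow> ('a \<Rightarrow> complex) \<Rightarrow> bool" where
  "hypercyclic_vector conv m a \<Phi> w f \<longleftrightarrow>
     f \<in> orlicz_space \<Phi> m \<and>
     orlicz_dense \<Phi> m (insert f {Lambda conv w a n f | n. n \<ge> 1})"

definition hypercyclic_weight ::
  "(('a::t2_space set \<Rightarrow> complex) \<Rightarrow> ('a set \<Rightarrow> complex) \<Rightarrow> 'a set \<Rightarrow> complex) \<Rightarrow>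
   'a measure \<Rightarrow> (int \<Rightarrow> 'a) \<Rightarrow> (real \<Rightarrow> ennreal) \<Rightarrow> ('a \<Rightarrow> real) \<Rightarrow> bool" where
  "hypercyclic_weight conv m a \<Phi> w \<longleftrightarrow> (\<exists>f. hypercyclic_vector conv m a \<Phi> w f)"

definition densely_hypercyclic_weight ::
  "(('a::t2_space set \<Rightarrow> complex) \<Rightarrow> ('a set \<Rightarrow> complex) \<Rightarrow> 'a set \<Rightarrow> complex) \<Rightarrow>
   'a measure \<Rightarrow> (int \<Rightarrow> 'a) \<Rightarrow> (real \<Rightarrow> ennreal) \<Rightarrow> ('a \<Rightarrow> real) \<Rightarrow> bool" where
  "densely_hypercyclic_weight conv m a \<Phi> w \<longleftrightarrow>
     hypercyclic_weight conv m a \<Phi> w \<and>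
     orlicz_dense \<Phi> m {f. hypercyclic_vector conv m a \<Phi> w f}"

definition weight_prod ::
  "(('a::t2_space set \<Rightarrow> complex) \<Rightarrow> ('a set \<Rightarrow> complex) \<Rightarrow> 'a set \<Rightarrow> complex) \<Rightarrow>
   ('a \<Rightarrow> 'a) \<Rightarrow> ('a \<Rightarrow> real) \<Rightarrow> (int \<Rightarrow> 'a) \<Rightarrow> nat \<Rightarrow> 'a \<Rightarrow> real" where
  "weight_prod conv invol w a n x =
     w x * (\<Prod>j=1..n. w (hg_mult conv x (invol (a (int j)))))"

definition weight_prod_shift ::
  "(('a::t2_space set \<Rightarrow> complex) \<Rightarrow> ('a set \<Rightarrow> complex) \<Rightarrow> 'a set \<Rightarrow> complex) \<Rightarrow>
   ('a \<Rightarrow> 'a) \<Rightarrow> ('a \<Rightarrow> real) \<Rightarrow> (int \<Rightarrow> 'a) \<Rightarrow> nat \<Rightarrow> 'a \<Rightarrow> real" where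
  "weight_prod_shift conv invol w a n x =
     weight_prod conv invol w a n (hg_mult conv x (a (int n)))"

text \<open>The supremum is taken in \<open>ennreal\<close>, so it is \<open>0\<close> on the empty set.\<close>

definition sup_norm_on :: "'a set \<Rightarrow> ('a \<Rightarrow> real) \<Rightarrow> ennreal" where
  "sup_norm_on A g = (SUP x\<in>A. ennreal \<bar>g x\<bar>)"

end

theory Submission
  imports Defs
begin

text \<open>
  Right translation by a central element \<open>z\<close> is a homeomorphism that preserves \<open>m\<close>, with inverse the
  translation by \<open>z\<^sup>-\<close>, so it does not change the Orlicz norm. Choose a hypercyclic vector \<open>f\<close> close to
  \<open>\<chi>\<^sub>E\<close> and a large \<open>n\<close> with \<open>\<Lambda>\<^sub>n f\<close> also close to \<open>\<chi>\<^sub>E\<close>. The sets \<open>P = {\<bar>f - \<chi>\<^sub>E\<bar> \<ge> \<epsilon>}\<close> and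
  \<open>Q = {\<bar>\<Lambda>\<^sub>n f - \<chi>\<^sub>E\<bar> \<ge> \<epsilon>}\<close> are small in norm, and so are their translates. By aperiodicity \<open>x a\<^sub>n\<close> and
  \<open>x a\<^sub>n\<^sup>-\<close> lie outside \<open>E\<close> for \<open>x \<in> E\<close>. Off the exceptional sets, \<open>\<Lambda>\<^sub>n f(x) = v\<^sub>n(x) f(x a\<^sub>n\<^sup>-)\<close> is close
  to \<open>1\<close> while \<open>f(x a\<^sub>n\<^sup>-)\<close> is close to \<open>0\<close>, so \<open>v\<^sub>n(x)\<close> is large; and
  \<open>\<Lambda>\<^sub>n f(x a\<^sub>n) = h\<^sub>n(x) f(x)\<close> is close to \<open>0\<close> while \<open>f(x)\<close> is close to \<open>1\<close>, so \<open>h\<^sub>n(x)\<close> is small.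
\<close>

section \<open>Non-negative Radon measures as set functions\<close>

text \<open>Convolution acts on set functions, while regularity and integration are stated for
  measures. This is the inverse of \<open>to_measure\<close> on finite Radon measures. Since
  \<open>measure\<close> is 0 outside the sigma-algebra, it respects the convention that complex
  measures vanish on non-Borel sets.\<close>

definition cmeasure :: "'a measure \<Rightarrow> 'a set \<Rightarrow> complex" where
  "cmeasure M A = complex_of_real (measure M A)"

lemma radon_measureD:
  assumes "radon_measure M"
  shows radon_measure_sets: "sets M = sets borel"
    and radon_measure_compact_finite: "compact C \<Longrightarrow> emeasure M C < \<infinity>"
    and radon_measure_outer_regular:
      "A \<in> sets borel \<Longrightarrow> emeasure M A = (INF U\<in>{U. open U \<and> A \<subseteq> U}. emeasure M U)"
    and radon_measure_inner_regular:
      "open U \<Longrightarrow> emeasure M U = (SUP C\<in>{C. compact C \<and> C \<subseteq> U}. emeasure M C)"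
proof -
  note r = assms[unfolded radon_measure_def]
  show "sets M = sets borel"
    by (rule conjunct1[OF r])
  show "emeasure M C < \<infinity>" if "compact C"
    by (rule conjunct1[OF conjunct2[OF r], rule_format]) fact
  show "emeasure M A = (INF U\<in>{U. open U \<and> A \<subseteq> U}. emeasure M U)" if "A \<in> sets borel"
    by (rule conjunct1[OF conjunct2[OF conjunct2[OF r]], rule_format]) fact
  show "emeasure M U = (SUP C\<in>{C. compact C \<and> C \<subseteq> U}. emeasure M C)" if "open U"
    by (rule conjunct2[OF conjunct2[OF conjunct2[OF r]], rule_format]) fact
qed

lemma space_eq_UNIV_of_sets_borel:
  "sets M = sets (borel :: 'a::topological_space measure) \<Longrightarrow> space M = UNIV"
  using sets_eq_imp_space_eq by fastforce

lemma measure_of_borel_cong: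
  fixes M :: "'a::topological_space measure"
  assumes "sets M = sets borel" and "\<And>A. A \<in> sets borel \<Longrightarrow> \<phi> A = emeasure M A"
  shows "measure_of UNIV (sets borel) \<phi> = M"
proof -
  have "measure_of UNIV (sets borel) \<phi> = measure_of (space M) (sets M) (emeasure M)"
    using assms space_eq_UNIV_of_sets_borel[OF assms(1)]
    by (metis measure_of_eq sets.sigma_sets_eq sets.space_closed space_borel)
  then show ?thesis
    by (simp add: measure_of_of_measure)
qed

lemma complex_borel_measure_cmeasure:
  assumes "finite_measure M" and "sets M = sets borel"
  shows "complex_borel_measure (cmeasure M)"
  unfolding complex_borel_measure_def cmeasure_def
  using finite_measure.finite_measure_UNION[OF assms(1)] assms(2)
  by (auto simp: measure_notin_sets intro!: sums_of_real)

text \<open>By finite additivity every admissible partition of \<open>A\<close> gives the same sum,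
  so the supremum is over a constant; the partition \<open>{A}\<close> shows that the family is
  non-empty.\<close>

lemma total_variation_cmeasure:
  assumes "finite_measure M" and "sets M = sets borel" and "A \<in> sets borel"
  shows "total_variation (cmeasure M) A = emeasure M A"
proof -
  interpret finite_measure M by fact
  let ?P = "{P. finite P \<and> disjoint P \<and> P \<subseteq> sets borel \<and> \<Union>P = A}"
  have "(\<Sum>B\<in>P. ennreal (cmod (cmeasure M B))) = emeasure M A" if "P \<in> ?P" for P
  proof -
    have "(\<Sum>B\<in>P. ennreal (cmod (cmeasure M B))) = (\<Sum>B\<in>P. emeasure M (id B))"
      by (simp add: cmeasure_def emeasure_eq_measure)
    also have "\<dots> = emeasure M (\<Union>B\<in>P. id B)"
      using that assms(2) by (intro sum_emeasure) (auto simp: disjoint_family_on_def disjoint_def)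
    finally show ?thesis using that by simp
  qed
  moreover have "{A} \<in> ?P" using assms(3) by auto
  ultimately show ?thesis
    unfolding total_variation_def by (metis (no_types, lifting) SUP_eq_const empty_iff)
qed

lemma to_measure_cmeasure:
  assumes "finite_measure M" and "sets M = sets borel"
  shows "to_measure (cmeasure M) = M"
  unfolding to_measure_def
  by (rule measure_of_borel_cong)
     (use assms in \<open>auto simp: cmeasure_def finite_measure.emeasure_eq_measure\<close>)

lemma measure_of_total_variation_cmeasure:
  assumes "finite_measure M" and "sets M = sets borel"
  shows "measure_of UNIV (sets borel) (total_variation (cmeasure M)) = M"
  by (rule measure_of_borel_cong) (use assms total_variation_cmeasure in auto)

lemma cmeasure_in_nonneg_radon_measures:
  assumes "finite_measure M" and "radon_measure M"
  shows "cmeasure M \<in> nonneg_radon_measures"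
proof -
  have "sets M = sets borel" by (rule radon_measure_sets) fact
  then show ?thesis
    using complex_borel_measure_cmeasure[OF assms(1)] measure_of_total_variation_cmeasure[OF assms(1)]
      assms(2)
    by (auto simp: nonneg_radon_measures_def complex_radon_measures_def)
       (simp add: cmeasure_def)
qed

text \<open>The values of \<open>\<mu>\<close> are real and non-negative, so taking real parts loses
  nothing and countable additivity passes to \<open>Re (\<mu> A)\<close>. Its total variation is
  then the measure itself, which is how the Radon property carries over.\<close>

lemma nonneg_radon_measureD:
  assumes "\<mu> \<in> nonneg_radon_measures"
  shows finite_measure_to_measure: "finite_measure (to_measure \<mu>)"
    and radon_measure_to_measure: "radon_measure (to_measure \<mu>)"
    and cmeasure_to_measure: "cmeasure (to_measure \<mu>) = \<mu>"
proof -
  have cbm: "complex_borel_measure \<mu>" and nn: "\<And>A. \<mu> A \<in> \<real>\<^sub>\<ge>\<^sub>0"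
    using assms by (auto simp: nonneg_radon_measures_def complex_radon_measures_def)
  have re: "\<mu> A = complex_of_real (Re (\<mu> A))" "0 \<le> Re (\<mu> A)" for A
    using nn[of A] by (auto simp: complex_nonneg_Reals_iff complex_eq_iff)
  have sums: "(\<lambda>i. \<mu> (A i)) sums \<mu> (\<Union>i. A i)"
    if "range A \<subseteq> sets borel" "disjoint_family A" for A :: "nat \<Rightarrow> 'a set"
    using cbm that by (auto simp: complex_borel_measure_def)
  \<comment> \<open>Additivity on the constant sequence of empty sets: a constant series converges
    only if its terms vanish.\<close>
  have "(\<lambda>i::nat. \<mu> {}) sums \<mu> {}"
    using sums[of "\<lambda>_. {}"] by (simp add: disjoint_family_on_def)
  then have empty: "\<mu> {} = 0"
    by (metis sums_iff summable_const_iff)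
  have em: "emeasure (to_measure \<mu>) A = ennreal (Re (\<mu> A))" if "A \<in> sets borel" for A
    unfolding to_measure_def
  proof (rule emeasure_measure_of_sigma)
    show "sigma_algebra UNIV (sets (borel :: 'a measure))"
      by (metis sets.sigma_algebra_axioms space_borel)
    show "positive (sets borel) (\<lambda>A. ennreal (Re (\<mu> A)))"
      by (simp add: positive_def empty)
    show "countably_additive (sets borel) (\<lambda>A. ennreal (Re (\<mu> A)))"
    proof (rule countably_additiveI)
      fix A :: "nat \<Rightarrow> 'a set"
      assume A: "range A \<subseteq> sets borel" "disjoint_family A"
      have "(\<lambda>i. Re (\<mu> (A i))) sums Re (\<mu> (\<Union>i. A i))"
        using sums[OF A] by (rule sums_Re)
      then show "(\<Sum>i. ennreal (Re (\<mu> (A i)))) = ennreal (Re (\<mu> (\<Union>i. A i)))"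
        using re(2) by (simp add: suminf_ennreal2 sums_iff)
    qed
  qed fact
  have sets: "sets (to_measure \<mu>) = sets borel"
    unfolding to_measure_def by (metis sets_measure_of sets.sigma_sets_eq sets.space_closed space_borel)
  show fin: "finite_measure (to_measure \<mu>)"
    by (rule finite_measureI) (simp add: space_eq_UNIV_of_sets_borel[OF sets] em)
  have "measure (to_measure \<mu>) A = Re (\<mu> A)" for A
  proof (cases "A \<in> sets borel")
    case True
    then show ?thesis using em re(2) by (simp add: measure_def)
  next
    case False
    then show ?thesis using cbm sets
      by (simp add: complex_borel_measure_def measure_notin_sets)
  qed
  then show cm: "cmeasure (to_measure \<mu>) = \<mu>"
    using re(1) by (simp add: cmeasure_def fun_eq_iff)
  show "radon_measure (to_measure \<mu>)"
    using assms measure_of_total_variation_cmeasure[OF fin sets]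
    by (simp add: cm nonneg_radon_measures_def complex_radon_measures_def)
qed

lemma nonneg_radon_imp_radon: "\<mu> \<in> nonneg_radon_measures \<Longrightarrow> \<mu> \<in> complex_radon_measures"
  by (simp add: nonneg_radon_measures_def)

lemma sets_to_measure: "\<mu> \<in> nonneg_radon_measures \<Longrightarrow> sets (to_measure \<mu>) = sets borel"
  using radon_measure_to_measure radon_measure_sets by blast

section \<open>Regularity of finite Radon measures and of the measures they dominate\<close>

lemma outer_regular_approx:
  assumes "radon_measure M" "finite_measure M" "A \<in> sets borel" "(0::ennreal) < \<epsilon>"
  obtains U where "open U" "A \<subseteq> U" "emeasure M (U - A) < \<epsilon>"
proof -
  interpret finite_measure M by fact
  have s: "sets M = sets borel" by (rule radon_measure_sets) fact
  have "emeasure M A = (INF U\<in>{U. open U \<and> A \<subseteq> U}. emeasure M U)"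
    by (rule radon_measure_outer_regular) fact+
  moreover have "emeasure M A < emeasure M A + \<epsilon>"
    using assms(4) emeasure_finite[of A]
    by (metis add.right_neutral ennreal_add_left_cancel_less infinity_ennreal_def)
  ultimately obtain U where U: "open U" "A \<subseteq> U" "emeasure M U < emeasure M A + \<epsilon>"
    by (auto simp: INF_less_iff)
  have "emeasure M U = emeasure M A + emeasure M (U - A)"
    using U assms(3) s by (metis borel_open Un_Diff_cancel Un_absorb1 Diff_disjoint plus_emeasure sets.Diff)
  with U(3) have "emeasure M (U - A) < \<epsilon>"
    by (simp add: ennreal_add_left_cancel_less)
  with U show ?thesis using that by blast
qed

lemma inner_regular_approx:
  assumes "radon_measure M" "finite_measure M" "open U" "(0::ennreal) < \<epsilon>"
  obtains C where "compact C" "C \<subseteq> U" "emeasure M (U - C) < \<epsilon>"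
proof -
  interpret finite_measure M by fact
  have s: "sets M = sets borel" by (rule radon_measure_sets) fact
  have eq: "emeasure M U = (SUP C\<in>{C. compact C \<and> C \<subseteq> U}. emeasure M C)"
    by (rule radon_measure_inner_regular) fact+
  \<comment> \<open>Written additively because subtraction in \<open>ennreal\<close> truncates at 0.
    If no such compact set existed, moving \<open>\<epsilon>\<close> out of the supremum would give
    \<open>emeasure M U + \<epsilon> \<le> emeasure M U\<close>, impossible for a finite
    value.\<close>
  have "\<exists>C. compact C \<and> C \<subseteq> U \<and> emeasure M U < emeasure M C + \<epsilon>"
  proof (rule ccontr)
    assume "\<nexists>C. compact C \<and> C \<subseteq> U \<and> emeasure M U < emeasure M C + \<epsilon>"
    then have "(SUP C\<in>{C. compact C \<and> C \<subseteq> U}. emeasure M C + \<epsilon>) \<le> emeasure M U"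
      by (intro SUP_least) (auto simp: not_less)
    also have "(SUP C\<in>{C. compact C \<and> C \<subseteq> U}. emeasure M C + \<epsilon>) = emeasure M U + \<epsilon>"
      unfolding eq by (rule ennreal_SUP_add_left) auto
    finally have "emeasure M U + \<epsilon> \<le> emeasure M U + 0" by simp
    then show False
      using assms(4) emeasure_finite[of U] unfolding ennreal_add_left_cancel_le by auto
  qed
  then obtain C where C: "compact C" "C \<subseteq> U" "emeasure M U < emeasure M C + \<epsilon>" by blast
  have "emeasure M U = emeasure M C + emeasure M (U - C)"
    using C assms(3) s by (metis borel_open borel_compact Un_Diff_cancel Un_absorb1 Diff_disjoint plus_emeasure sets.Diff)
  with C(3) have "emeasure M (U - C) < \<epsilon>"
    by (simp add: ennreal_add_left_cancel_less)
  with C show ?thesis using that by blast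
qed

text \<open>Approximating a set from outside or inside with error \<open>\<delta>\<close> for
  \<open>M\<close> gives error at most \<open>k * \<delta>\<close> for \<open>N\<close>, so
  regularity is inherited. This yields the Radon property of restrictions and normalized
  restrictions.\<close>

lemma radon_measure_dominated:
  fixes M N :: "'a::t2_space measure" and k :: real
  assumes rad: "radon_measure M" and fin: "finite_measure M" and sN: "sets N = sets borel" and "0 \<le> k"
    and le: "\<And>A. A \<in> sets borel \<Longrightarrow> emeasure N A \<le> ennreal k * emeasure M A"
  shows "finite_measure N" "radon_measure N"
proof -
  interpret M: finite_measure M by fact
  note sM = radon_measure_sets[OF rad]
  have N_finite: "emeasure N A < \<infinity>" for A
  proof (cases "A \<in> sets borel")
    case True
    have "ennreal k * emeasure M A < \<infinity>"
      by (simp add: M.emeasure_eq_measure ennreal_mult''[symmetric])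
    with le[OF True] show ?thesis by (rule order.strict_trans1)
  qed (simp add: sN emeasure_notin_sets)
  show "finite_measure N"
    using N_finite[of "space N"] by (intro finite_measureI) auto
  \<comment> \<open>Dividing by \<open>k + 1\<close> instead of \<open>k\<close> also covers
    \<open>k = 0\<close>.\<close>
  have small: "emeasure N B \<le> ennreal \<epsilon>"
    if "B \<in> sets borel" "emeasure M B < ennreal (\<epsilon> / (k + 1))" "0 < \<epsilon>" for B \<epsilon>
  proof -
    have "emeasure N B \<le> ennreal k * emeasure M B" using le that(1) by blast
    also have "\<dots> \<le> ennreal k * ennreal (\<epsilon> / (k + 1))"
      using that(2) by (intro mult_left_mono) auto
    also have "\<dots> = ennreal (k * (\<epsilon> / (k + 1)))"
      using \<open>0 \<le> k\<close> that(3) by (intro ennreal_mult[symmetric]) auto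
    also have "\<dots> \<le> ennreal \<epsilon>"
      using \<open>0 \<le> k\<close> that(3) by (intro ennreal_leI) (simp add: field_simps)
    finally show ?thesis .
  qed
  have split: "emeasure N U = emeasure N A + emeasure N (U - A)"
    if "A \<subseteq> U" "A \<in> sets borel" "U \<in> sets borel" for A U
    using that sN by (metis Un_Diff_cancel Un_absorb1 Diff_disjoint plus_emeasure sets.Diff)
  have outer: "emeasure N A = (INF U\<in>{U. open U \<and> A \<subseteq> U}. emeasure N U)" if A: "A \<in> sets borel" for A
  proof (rule antisym)
    show "emeasure N A \<le> (INF U\<in>{U. open U \<and> A \<subseteq> U}. emeasure N U)"
      by (intro INF_greatest emeasure_mono) (auto simp: sN)
    show "(INF U\<in>{U. open U \<and> A \<subseteq> U}. emeasure N U) \<le> emeasure N A"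
    proof (rule ennreal_le_epsilon)
      fix \<epsilon> :: real assume \<epsilon>: "0 < \<epsilon>"
      have pos: "0 < ennreal (\<epsilon> / (k + 1))" using \<epsilon> \<open>0 \<le> k\<close> by simp
      obtain U where U: "open U" "A \<subseteq> U" "emeasure M (U - A) < ennreal (\<epsilon> / (k + 1))"
        by (rule outer_regular_approx[OF rad fin A pos])
      have "(INF U\<in>{U. open U \<and> A \<subseteq> U}. emeasure N U) \<le> emeasure N U"
        using U by (intro INF_lower) auto
      also have "\<dots> \<le> emeasure N A + ennreal \<epsilon>"
        unfolding split[OF U(2) A borel_open[OF U(1)]]
        using U A \<epsilon> by (intro add_left_mono small) auto
      finally show "(INF U\<in>{U. open U \<and> A \<subseteq> U}. emeasure N U) \<le> emeasure N A + ennreal \<epsilon>" .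
    qed
  qed
  have inner: "emeasure N U = (SUP C\<in>{C. compact C \<and> C \<subseteq> U}. emeasure N C)" if U: "open U" for U
  proof (rule antisym)
    show "(SUP C\<in>{C. compact C \<and> C \<subseteq> U}. emeasure N C) \<le> emeasure N U"
      using U by (intro SUP_least emeasure_mono) (auto simp: sN)
    show "emeasure N U \<le> (SUP C\<in>{C. compact C \<and> C \<subseteq> U}. emeasure N C)"
    proof (rule ennreal_le_epsilon)
      fix \<epsilon> :: real assume \<epsilon>: "0 < \<epsilon>"
      have pos: "0 < ennreal (\<epsilon> / (k + 1))" using \<epsilon> \<open>0 \<le> k\<close> by simp
      obtain C where C: "compact C" "C \<subseteq> U" "emeasure M (U - C) < ennreal (\<epsilon> / (k + 1))"
        by (rule inner_regular_approx[OF rad fin U pos])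
      have "emeasure N U \<le> emeasure N C + ennreal \<epsilon>"
        unfolding split[OF C(2) borel_compact[OF C(1)] borel_open[OF U]]
        using U C \<epsilon> by (intro add_left_mono small) (auto simp: borel_compact)
      also have "\<dots> \<le> (SUP C\<in>{C. compact C \<and> C \<subseteq> U}. emeasure N C) + ennreal \<epsilon>"
        using C by (intro add_right_mono SUP_upper) auto
      finally show "emeasure N U \<le> (SUP C\<in>{C. compact C \<and> C \<subseteq> U}. emeasure N C) + ennreal \<epsilon>" .
    qed
  qed
  show "radon_measure N"
    unfolding radon_measure_def
  proof (intro conjI allI impI ballI)
    show "sets N = sets borel" by (rule sN)
    show "emeasure N C < \<infinity>" for C by (rule N_finite)
    show "emeasure N A = (INF U\<in>{U. open U \<and> A \<subseteq> U}. emeasure N U)" if "A \<in> sets borel" for A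
      by (rule outer[OF that])
    show "emeasure N U = (SUP C\<in>{C. compact C \<and> C \<subseteq> U}. emeasure N C)" if "open U" for U
      by (rule inner[OF that])
  qed
qed

lemma radon_uniform_measure:
  fixes M :: "'a::t2_space measure"
  assumes rad: "radon_measure M" and fin: "finite_measure M" and V: "V \<in> sets borel" "emeasure M V \<noteq> 0"
  shows "finite_measure (uniform_measure M V)" "radon_measure (uniform_measure M V)"
proof -
  interpret finite_measure M by fact
  have s: "sets M = sets borel" by (rule radon_measure_sets) fact
  have pos: "measure M V > 0" using V by (simp add: emeasure_eq_measure zero_less_measure_iff)
  have "emeasure (uniform_measure M V) A \<le> ennreal (1 / measure M V) * emeasure M A"
    if "A \<in> sets borel" for A
  proof -
    have "emeasure (uniform_measure M V) A = ennreal (measure M (V \<inter> A) / measure M V)"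
      using that V s pos by (simp add: emeasure_eq_measure divide_ennreal)
    also have "\<dots> \<le> ennreal (1 / measure M V * measure M A)"
      using pos that s by (intro ennreal_leI) (auto intro!: divide_right_mono finite_measure_mono)
    also have "\<dots> = ennreal (1 / measure M V) * emeasure M A"
      using pos by (simp only: emeasure_eq_measure ennreal_mult'[OF measure_nonneg] mult.commute)
    finally show ?thesis .
  qed
  then show "finite_measure (uniform_measure M V)" "radon_measure (uniform_measure M V)"
    using radon_measure_dominated[OF rad fin, of "uniform_measure M V" "1 / measure M V"] s pos by auto
qed

lemma radon_density_indicator:
  fixes M :: "'a::t2_space measure"
  assumes rad: "radon_measure M" and fin: "finite_measure M" and V: "V \<in> sets borel"
  shows "finite_measure (density M (indicator V))" "radon_measure (density M (indicator V))"
proof -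
  have s: "sets M = sets borel" by (rule radon_measure_sets) fact
  have "emeasure (density M (indicator V)) A \<le> ennreal 1 * emeasure M A" if "A \<in> sets borel" for A
    using that V s by (auto simp: emeasure_density indicator_inter_arith[symmetric] intro!: emeasure_mono)
  then show "finite_measure (density M (indicator V))" "radon_measure (density M (indicator V))"
    using radon_measure_dominated[OF rad fin, of "density M (indicator V)" 1] s by auto
qed

lemma measure_to_measure:
  assumes "\<mu> \<in> nonneg_radon_measures"
  shows "measure (to_measure \<mu>) A = Re (\<mu> A)" "emeasure (to_measure \<mu>) A = ennreal (Re (\<mu> A))"
proof -
  show "measure (to_measure \<mu>) A = Re (\<mu> A)"
    using cmeasure_to_measure[OF assms] by (metis cmeasure_def Re_complex_of_real)
  then show "emeasure (to_measure \<mu>) A = ennreal (Re (\<mu> A))"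
    by (simp add: finite_measure.emeasure_eq_measure[OF finite_measure_to_measure[OF assms]])
qed

section \<open>Point masses, support points and compactly supported cutoff functions\<close>

lemma integral_point_mass:
  fixes f :: "'a::t2_space \<Rightarrow> 'b::{banach,second_countable_topology}"
  assumes pm: "point_mass x \<in> nonneg_radon_measures" and f: "f \<in> borel_measurable borel"
  shows "(LINT u|to_measure (point_mass x). f u) = f x"
proof -
  let ?D = "to_measure (point_mass x)"
  have s: "sets ?D = sets borel" using sets_to_measure[OF pm] .
  have sp: "space ?D = UNIV" using space_eq_UNIV_of_sets_borel[OF s] .
  have "AE u in ?D. u = x"
    by (rule AE_I[of _ _ "- {x}"])
       (auto simp: s measure_to_measure[OF pm] point_mass_def borel_closed)
  moreover have "f \<in> borel_measurable ?D" using f measurable_cong_sets[OF s refl] by auto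
  ultimately have "(LINT u|?D. f u) = (LINT u|?D. f x)"
    by (intro integral_cong_AE) (auto elim: eventually_mono)
  also have "\<dots> = f x"
    by (simp add: sp measure_to_measure[OF pm] point_mass_def)
  finally show ?thesis .
qed

text \<open>If every point had an open null neighbourhood, finitely many of them would cover any
  compact set. All compact sets would be null, and by inner regularity so would the whole
  space.\<close>

lemma radon_measure_support_point:
  assumes rad: "radon_measure M" and "emeasure M UNIV \<noteq> 0"
  obtains u where "\<And>V. open V \<Longrightarrow> u \<in> V \<Longrightarrow> emeasure M V \<noteq> 0"
proof (rule ccontr)
  assume "\<not> thesis"
  then have "\<forall>u. \<exists>V. open V \<and> u \<in> V \<and> emeasure M V = 0" using that by blast
  then obtain V where V: "\<And>u. open (V u)" "\<And>u. u \<in> V u" "\<And>u. emeasure M (V u) = 0" by metis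
  have s: "sets M = sets borel" by (rule radon_measure_sets) fact
  have "emeasure M C = 0" if C: "compact C" for C
  proof -
    obtain F where F: "F \<subseteq> C" "finite F" "C \<subseteq> (\<Union>u\<in>F. V u)"
      using compactE_image[OF C, of C V] V by blast
    have "emeasure M C \<le> emeasure M (\<Union>u\<in>F. V u)"
      using F V s by (intro emeasure_mono) auto
    also have "\<dots> \<le> (\<Sum>u\<in>F. emeasure M (V u))"
      using F V s by (intro emeasure_subadditive_finite) auto
    also have "\<dots> = 0" using V by simp
    finally show ?thesis by simp
  qed
  then have "(SUP C\<in>{C. compact C \<and> C \<subseteq> UNIV}. emeasure M C) \<le> 0"
    by (intro SUP_least) auto
  then show False
    using radon_measure_inner_regular[OF rad open_UNIV] assms(2) by (metis le_zero_eq)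
qed

lemma Hausdorff_space_euclidean_t2: "Hausdorff_space (euclidean :: 'a::t2_space topology)"
  unfolding Hausdorff_space_def disjnt_def by (metis hausdorff open_openin)

lemma Urysohn_compact_support:
  fixes U C :: "'a::t2_space set"
  assumes lc: "locally_compact_space (euclidean :: 'a topology)" and "compact C" "open U" "C \<subseteq> U"
  obtains f :: "'a \<Rightarrow> real" where "f \<in> Cc" "\<And>x. 0 \<le> f x" "\<And>x. f x \<le> 1"
    "\<And>x. x \<in> C \<Longrightarrow> f x = 1" "\<And>x. x \<notin> U \<Longrightarrow> f x = 0"
proof -
  \<comment> \<open>Urysohn's lemma is applied with \<open>U \<inter> V\<close> in place of
    \<open>U\<close>, where \<open>V\<close> lies in a compact set \<open>L\<close>; this forces the
    support of \<open>f\<close> into \<open>L\<close>.\<close>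
  obtain V L where VL: "open V" "compact L" "C \<subseteq> V" "V \<subseteq> L"
    using lc \<open>compact C\<close> locally_compact_space_compact_closed_compact[of "euclidean :: 'a topology"]
      Hausdorff_space_euclidean_t2
    by (metis compactin_euclidean_iff open_openin)
  have "completely_regular_space (euclidean :: 'a topology)"
    using lc by (intro locally_compact_regular_imp_completely_regular_space) (auto simp: Hausdorff_space_euclidean_t2)
  moreover have "closedin euclidean (- (U \<inter> V))" using VL assms by auto
  ultimately obtain f :: "'a \<Rightarrow> real" where
    f: "continuous_map euclidean (top_of_set {0..1}) f" "f ` (- (U \<inter> V)) \<subseteq> {0}" "f ` C \<subseteq> {1}"
    using Urysohn_completely_regular_compact_closed[of 0 1 "euclidean :: 'a topology" C "- (U \<inter> V)"]
      assms VL by (auto simp: disjnt_def)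
  show thesis
  proof
    have "closure {x. f x \<noteq> 0} \<subseteq> L"
      using f(2) VL by (intro closure_minimal) (auto intro: compact_imp_closed)
    then have "compact (closure {x. f x \<noteq> 0})"
      using \<open>compact L\<close> by (metis closed_closure compact_Int_closed inf.absorb2)
    moreover have "continuous_on UNIV f" using f(1) by (auto simp: continuous_map_in_subtopology)
    ultimately show "f \<in> Cc" by (simp add: Cc_def)
    show "0 \<le> f x" "f x \<le> 1" for x
      using f(1) by (auto simp: continuous_map_in_subtopology image_subset_iff Pi_iff)
  qed (use f in auto)
qed

section \<open>Approximating point masses in the cone topology\<close>

lemma topspace_cone_topology: "topspace cone_topology = (nonneg_radon_measures :: ('a::t2_space set \<Rightarrow> complex) set)"
proof -
  \<comment> \<open>The generating set for \<open>f = 1\<close> and \<open>V = UNIV\<close> is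
    already the set of all non-negative Radon measures.\<close>
  have "{\<mu> \<in> (nonneg_radon_measures :: ('a set \<Rightarrow> complex) set). (LINT x|to_measure \<mu>. (1::real)) \<in> UNIV} \<in>
    {{\<mu> \<in> nonneg_radon_measures. (LINT x|to_measure \<mu>. f x) \<in> V} | (f :: 'a \<Rightarrow> real) V.
        open V \<and> (f \<in> Cc \<and> (\<forall>x. 0 \<le> f x) \<or> f = (\<lambda>x. 1))}"
    by blast
  then show ?thesis
    unfolding cone_topology_def topology_generated_by_topspace by blast
qed

lemma openin_cone_topology_integral:
  fixes f :: "'a::t2_space \<Rightarrow> real"
  assumes "f \<in> Cc" "\<And>x. 0 \<le> f x" "open V"
  shows "openin cone_topology {\<mu> \<in> nonneg_radon_measures. (LINT x|to_measure \<mu>. f x) \<in> V}"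
  unfolding cone_topology_def by (rule topology_generated_by_Basis) (use assms in blast)

text \<open>On a generating set of the topology this says that averages of a continuous function
  over small neighbourhoods of \<open>u\<close> approach its value at \<open>u\<close>. Induction
  over generated open sets does the rest; quantifying over all smaller \<open>N\<close> is what lets
  two neighbourhoods be intersected in the case of an intersection.\<close>

lemma normalized_restriction_tends_to_point_mass:
  fixes M :: "'a::t2_space measure"
  assumes rad: "radon_measure M" and fin: "finite_measure M"
    and u: "\<And>V. open V \<Longrightarrow> u \<in> V \<Longrightarrow> emeasure M V \<noteq> 0"
    and pm: "point_mass u \<in> nonneg_radon_measures"
    and S: "openin cone_topology S" "point_mass u \<in> S"
  shows "\<exists>V. open V \<and> u \<in> V \<and> (\<forall>N. open N \<and> u \<in> N \<and> N \<subseteq> V \<longrightarrow> cmeasure (uniform_measure M N) \<in> S)"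
proof -
  interpret finite_measure M by fact
  have s: "sets M = sets borel" by (rule radon_measure_sets) fact
  let ?B = "{{\<mu> \<in> nonneg_radon_measures. (LINT x|to_measure \<mu>. f x) \<in> V} | (f :: 'a \<Rightarrow> real) V.
        open V \<and> (f \<in> Cc \<and> (\<forall>x. 0 \<le> f x) \<or> f = (\<lambda>x. 1))}"
  have "generate_topology_on ?B S"
    using S(1) unfolding cone_topology_def by (rule openin_topology_generated_by)
  then show ?thesis using S(2)
  proof induction
    case Empty
    then show ?case by simp
  next
    case (Int A B)
    then obtain V W where
      "open V" "u \<in> V" "\<forall>N. open N \<and> u \<in> N \<and> N \<subseteq> V \<longrightarrow> cmeasure (uniform_measure M N) \<in> A"
      "open W" "u \<in> W" "\<forall>N. open N \<and> u \<in> N \<and> N \<subseteq> W \<longrightarrow> cmeasure (uniform_measure M N) \<in> B"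
      by blast
    then show ?case by (intro exI[of _ "V \<inter> W"]) (simp add: open_Int)
  next
    case (UN K)
    then obtain A where A: "A \<in> K" "point_mass u \<in> A" by blast
    show ?case using UN.IH[OF A] A(1) by blast
  next
    case (Basis S)
    then obtain f :: "'a \<Rightarrow> real" and W where
      S: "S = {\<mu> \<in> nonneg_radon_measures. (LINT x|to_measure \<mu>. f x) \<in> W}" and "open W"
      and f: "f \<in> Cc \<and> (\<forall>x. 0 \<le> f x) \<or> f = (\<lambda>x. 1)"
      by blast
    have cont: "continuous_on UNIV f" using f by (auto simp: Cc_def)
    then have fb: "f \<in> borel_measurable borel" by (rule borel_measurable_continuous_onI)
    then have "f u \<in> W" using Basis(2) integral_point_mass[OF pm fb] by (simp add: S)
    \<comment> \<open>A closed ball, because averaging the strict bound on \<open>N\<close> is only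
      used to give the weak bound \<open>\<le> \<epsilon>\<close>.\<close>
    then obtain \<epsilon> where \<epsilon>: "0 < \<epsilon>" "cball (f u) \<epsilon> \<subseteq> W"
      using \<open>open W\<close> by (meson open_contains_cball)
    let ?V = "f -` ball (f u) \<epsilon>"
    show ?case
    proof (intro exI conjI allI impI)
      show "open ?V" using cont by (intro open_vimage) auto
      show "u \<in> ?V" using \<epsilon> by simp
      fix N assume N: "open N \<and> u \<in> N \<and> N \<subseteq> ?V"
      let ?U = "uniform_measure M N"
      have pos: "emeasure M N \<noteq> 0" using u N by blast
      have Nb: "N \<in> sets borel" using N by auto
      note U = radon_uniform_measure[OF rad fin Nb pos]
      interpret U: finite_measure ?U by fact
      have mU: "measure ?U (space M) = 1"
        using pos s N Nb by (simp add: space_eq_UNIV_of_sets_borel[OF s] emeasure_eq_measure)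
      have fU: "f \<in> borel_measurable ?U" using fb s by (simp cong: measurable_cong_sets)
      have "\<bar>f x - f u\<bar> \<le> \<epsilon>" if "x \<in> N" for x
        using N that by (auto simp: dist_real_def)
      then have AE: "AE x in ?U. \<bar>f x - f u\<bar> \<le> \<epsilon>"
        using Nb s by (intro AE_uniform_measureI AE_I2) auto
      have "AE x in ?U. norm (f x) \<le> \<bar>f u\<bar> + \<epsilon>"
        using AE by (rule eventually_mono) auto
      then have int: "integrable ?U f" using fU by (rule U.integrable_const_bound)
      have "(LINT x|?U. \<bar>f x - f u\<bar>) \<le> (LINT x|?U. \<epsilon>)"
        using int AE by (intro integral_mono_AE integrable_abs Bochner_Integration.integrable_diff U.integrable_const)
      then have "(LINT x|?U. \<bar>f x - f u\<bar>) \<le> \<epsilon>" by (simp add: mU)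
      moreover have "\<bar>LINT x|?U. f x - f u\<bar> \<le> (LINT x|?U. \<bar>f x - f u\<bar>)"
        by (rule integral_abs_bound)
      moreover have "(LINT x|?U. f x - f u) = (LINT x|?U. f x) - f u"
        by (subst Bochner_Integration.integral_diff) (simp_all add: int mU)
      ultimately have "(LINT x|?U. f x) \<in> cball (f u) \<epsilon>" by (simp add: dist_real_def)
      moreover have "to_measure (cmeasure ?U) = ?U"
        using U s by (intro to_measure_cmeasure) auto
      ultimately show "cmeasure ?U \<in> S"
        using \<epsilon>(2) cmeasure_in_nonneg_radon_measures[OF U] by (simp add: S subset_iff)
    qed
  qed
qed

section \<open>Translation by central elements\<close>

lemma measure_density_indicator:
  assumes "V \<in> sets M" "A \<in> sets M"
  shows "measure (density M (indicator V)) A = measure M (V \<inter> A)"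
  using assms by (simp add: measure_def emeasure_density indicator_inter_arith[symmetric])

text \<open>Together with \<open>cmeasure_density_indicator\<close> this writes \<open>M\<close> as
  a multiple of its normalized restriction to \<open>V\<close> plus a non-negative remainder, the
  form to which bilinearity of \<open>conv\<close> applies.\<close>

lemma cmeasure_split:
  fixes M :: "'a::t2_space measure"
  assumes fin: "finite_measure M" and s: "sets M = sets borel" and V: "V \<in> sets borel"
  shows "cmeasure M = (\<lambda>A. cmeasure (density M (indicator V)) A + cmeasure (density M (indicator (- V))) A)"
proof
  interpret finite_measure M by fact
  have V': "- V \<in> sets borel" using V by (metis sets.compl_sets space_borel Compl_eq_Diff_UNIV)
  fix A
  show "cmeasure M A = cmeasure (density M (indicator V)) A + cmeasure (density M (indicator (- V))) A"
  proof (cases "A \<in> sets borel")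
    case True
    have "measure M ((V \<inter> A) \<union> (- V \<inter> A)) = measure M (V \<inter> A) + measure M (- V \<inter> A)"
      using True V V' s by (intro finite_measure_Union) auto
    moreover have "(V \<inter> A) \<union> (- V \<inter> A) = A" by blast
    ultimately show ?thesis
      using True V V' s by (simp add: cmeasure_def measure_density_indicator)
  qed (use s in \<open>simp add: cmeasure_def measure_notin_sets\<close>)
qed

lemma cmeasure_density_indicator:
  fixes M :: "'a::t2_space measure"
  assumes fin: "finite_measure M" and s: "sets M = sets borel" and V: "V \<in> sets borel" "emeasure M V \<noteq> 0"
  shows "cmeasure (density M (indicator V)) =
           (\<lambda>A. complex_of_real (measure M V) * cmeasure (uniform_measure M V) A)"
proof
  interpret finite_measure M by fact
  have pos: "measure M V > 0" using V by (simp add: emeasure_eq_measure zero_less_measure_iff)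
  fix A
  show "cmeasure (density M (indicator V)) A =
          complex_of_real (measure M V) * cmeasure (uniform_measure M V) A"
  proof (cases "A \<in> sets borel")
    case True
    then show ?thesis
      using V s pos emeasure_finite[of V] by (simp add: cmeasure_def measure_density_indicator)
  qed (use s in \<open>simp add: cmeasure_def measure_notin_sets\<close>)
qed

lemma supp_point_mass:
  assumes pm: "point_mass x \<in> nonneg_radon_measures"
  shows "supp (point_mass x) = {x}"
proof -
  have tv: "total_variation (point_mass x) U = ennreal (Re (point_mass x U))" if "open U" for U
    using total_variation_cmeasure[OF finite_measure_to_measure[OF pm] sets_to_measure[OF pm], of U]
      measure_to_measure[OF pm, of U] cmeasure_to_measure[OF pm] that by simp
  show ?thesis
  proof
    show "{x} \<subseteq> supp (point_mass x)"
      by (auto simp: supp_def tv point_mass_def)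
    show "supp (point_mass x) \<subseteq> {x}"
    proof
      fix y assume "y \<in> supp (point_mass x)"
      then have "y \<notin> - {x}"
        using tv[of "- {x}"] by (auto simp: supp_def point_mass_def open_Compl)
      then show "y \<in> {x}" by simp
    qed
  qed
qed

lemma point_mass_inject:
  fixes x y :: "'a::t2_space"
  assumes "point_mass x = point_mass y"
  shows "x = y"
proof -
  have "{x} \<in> sets borel" by (simp add: borel_closed)
  then have "point_mass x {x} = 1" by (simp add: point_mass_def)
  then have "point_mass y {x} = 1" by (simp add: assms)
  then show ?thesis by (simp add: point_mass_def split: if_splits)
qed

section \<open>Products with central point masses are point masses\<close>

context hypergroup
begin

text \<open>The axioms assert this only for products of point masses; multiplying by the unit turns
  \<open>point_mass x\<close> into such a product.\<close>

lemma point_mass_nonneg: "point_mass (x::'a) \<in> nonneg_radon_measures"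
  using point_conv_prob(1)[of x e] unit(1) by simp

lemma point_mass_radon: "point_mass (x::'a) \<in> complex_radon_measures"
  by (rule nonneg_radon_imp_radon[OF point_mass_nonneg])

text \<open>Splitting \<open>M\<close> along \<open>V\<close> and expanding by linearity gives two
  non-negative numbers with sum 0, so both vanish; the factor \<open>measure M V\<close> is positive
  and can be cancelled.\<close>

lemma conv_normalized_restriction_null:
  assumes rad: "radon_measure M" and fin: "finite_measure M" and V: "V \<in> sets borel" "emeasure M V \<noteq> 0"
    and null: "conv (cmeasure M) (point_mass y) A = 0"
  shows "conv (cmeasure (uniform_measure M V)) (point_mass y) A = 0"
proof -
  interpret finite_measure M by fact
  have sM: "sets M = sets borel" by (rule radon_measure_sets) fact
  let ?U = "cmeasure (uniform_measure M V)" and ?W = "cmeasure (density M (indicator (- V)))"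
  let ?p = "complex_of_real (measure M V)"
  have U: "?U \<in> nonneg_radon_measures"
    by (intro cmeasure_in_nonneg_radon_measures radon_uniform_measure rad fin V)
  have "- V \<in> sets borel" using V by (metis sets.compl_sets space_borel Compl_eq_Diff_UNIV)
  then have W: "?W \<in> nonneg_radon_measures"
    by (intro cmeasure_in_nonneg_radon_measures radon_density_indicator rad fin)
  have R: "(\<lambda>A. ?p * ?U A) \<in> complex_radon_measures"
    unfolding cmeasure_density_indicator[OF fin sM V, symmetric]
    by (intro nonneg_radon_imp_radon cmeasure_in_nonneg_radon_measures radon_density_indicator rad fin V)
  have "conv (cmeasure M) (point_mass y) = conv (\<lambda>A. ?p * ?U A + ?W A) (point_mass y)"
    by (subst cmeasure_split[OF fin sM V(1)]) (simp only: cmeasure_density_indicator[OF fin sM V])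
  also have "\<dots> = (\<lambda>A. conv (\<lambda>A. ?p * ?U A) (point_mass y) A + conv ?W (point_mass y) A)"
    by (rule conv_add_left[OF R nonneg_radon_imp_radon[OF W] point_mass_radon])
  also have "conv (\<lambda>A. ?p * ?U A) (point_mass y) = (\<lambda>A. ?p * conv ?U (point_mass y) A)"
    by (rule conv_scale_left[OF nonneg_radon_imp_radon[OF U] point_mass_radon])
  finally have eq: "?p * conv ?U (point_mass y) A + conv ?W (point_mass y) A = 0"
    using null by simp
  have "conv ?U (point_mass y) A \<in> \<real>\<^sub>\<ge>\<^sub>0" "conv ?W (point_mass y) A \<in> \<real>\<^sub>\<ge>\<^sub>0"
    using conv_nonneg[OF U point_mass_nonneg] conv_nonneg[OF W point_mass_nonneg]
    by (auto simp: nonneg_radon_measures_def)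
  moreover have "measure M V > 0" using V by (simp add: emeasure_eq_measure zero_less_measure_iff)
  ultimately show ?thesis
    using eq by (auto simp: complex_nonneg_Reals_iff complex_eq_iff add_nonneg_eq_0_iff)
qed

text \<open>Let \<open>u\<close> be in the support of \<open>\<mu> = \<delta>\<^sub>x * \<delta>\<^sub>z\<close>. The parts of \<open>\<mu>\<close> near \<open>u\<close>, normalized, tend to
  \<open>\<delta>\<^sub>u\<close>, and their products with \<open>\<delta>\<close> at \<open>z\<^sup>-\<close> are dominated by multiples of \<open>\<mu> * \<delta>\<close> at \<open>z\<^sup>-\<close>, which
  is \<open>\<delta>\<^sub>x\<close>. By continuity \<open>\<delta>\<^sub>u * \<delta>\<close> at \<open>z\<^sup>-\<close> is \<open>\<delta>\<^sub>x\<close>; multiply by \<open>\<delta>\<^sub>z\<close> to get \<open>\<delta>\<^sub>u = \<mu>\<close>.\<close>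

lemma central_conv_point_mass:
  assumes z: "z \<in> hg_center conv invol e"
  obtains u where "conv (point_mass x) (point_mass z) = point_mass u"
proof -
  let ?\<mu> = "conv (point_mass x) (point_mass z)" and ?z = "point_mass (invol z)"
  let ?M = "to_measure ?\<mu>"
  have cz: "conv (point_mass z) ?z = point_mass e" "conv ?z (point_mass z) = point_mass e"
    using z by (auto simp: hg_center_def)
  note \<mu> = point_conv_prob(1)[of x z]
  note rad = radon_measure_to_measure[OF \<mu>] and fin = finite_measure_to_measure[OF \<mu>]
  have cancel: "conv ?\<mu> ?z = point_mass x"
    using conv_assoc[OF point_mass_radon point_mass_radon point_mass_radon, of x z "invol z"]
    by (simp add: cz unit)
  have "emeasure ?M UNIV \<noteq> 0"
    using measure_to_measure[OF \<mu>] point_conv_prob(2)[of x z] by simp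
  then obtain u where u: "\<And>V. open V \<Longrightarrow> u \<in> V \<Longrightarrow> emeasure ?M V \<noteq> 0"
    using radon_measure_support_point[OF rad] by metis
  let ?\<tau> = "conv (point_mass u) ?z"
  let ?T = "to_measure ?\<tau>"
  note \<tau> = point_conv_prob(1)[of u "invol z"]
  interpret T: finite_measure ?T by (rule finite_measure_to_measure[OF \<tau>])
  note sT = sets_to_measure[OF \<tau>]
  \<comment> \<open>The aim is that \<open>?\<tau>\<close> has no mass off \<open>x\<close>. Compact
    sets suffice by inner regularity on the open set \<open>- {x}\<close>, and for them a cutoff
    function is available.\<close>
  have null: "emeasure ?T C = 0" if C: "compact C" "C \<subseteq> - {x}" for C
  proof (rule ccontr)
    assume ne: "emeasure ?T C \<noteq> 0"
    obtain f :: "'a \<Rightarrow> real" where f: "f \<in> Cc" "\<And>x. 0 \<le> f x" "\<And>x. f x \<le> 1"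
      "\<And>x. x \<in> C \<Longrightarrow> f x = 1" "\<And>y. y \<notin> - {x} \<Longrightarrow> f y = 0"
      by (rule Urysohn_compact_support[OF locally_compact, of C "- {x}"]) (use C in auto)
    have fb: "f \<in> borel_measurable borel"
      using f(1) by (auto simp: Cc_def intro: borel_measurable_continuous_onI)
    have Cb: "C \<in> sets borel" using C by (simp add: borel_compact)
    have "measure ?T C = (LINT y|?T. indicator C y)"
      using Cb sT space_eq_UNIV_of_sets_borel[OF sT] by simp
    also have "\<dots> \<le> (LINT y|?T. f y)"
    proof (rule integral_mono)
      show "integrable ?T (indicator C :: 'a \<Rightarrow> real)"
        using Cb sT by (intro integrable_real_indicator) (auto simp: T.emeasure_eq_measure)
      show "integrable ?T f"
        using fb sT f(2,3) by (intro T.integrable_const_bound[of _ 1]) (auto cong: measurable_cong_sets)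
    qed (use f in \<open>auto simp: indicator_def\<close>)
    finally have "measure ?T C \<le> (LINT y|?T. f y)" .
    moreover have "0 < measure ?T C"
      using ne by (simp add: T.emeasure_eq_measure zero_less_measure_iff)
    ultimately have pos: "0 < (LINT y|?T. f y)" by linarith
    \<comment> \<open>A cone-open set that contains \<open>?\<tau>\<close>. By continuity it must
      also contain the product of \<open>?z\<close> with some normalized restriction of
      \<open>?M\<close> near \<open>u\<close>; but that product gives no mass to
      \<open>- {x}\<close>, and \<open>f\<close> vanishes at \<open>x\<close>.\<close>
    let ?S = "{\<mu> \<in> nonneg_radon_measures. (LINT x|to_measure \<mu>. f x) \<in> {0<..}}"
    have "continuous_map cone_topology cone_topology (\<lambda>\<rho>. conv \<rho> ?z)"
    proof -
      have "continuous_map cone_topology (prod_topology cone_topology cone_topology) (\<lambda>\<rho>. (\<rho>, ?z))"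
        by (intro continuous_map_pairedI continuous_map_id[unfolded id_def])
           (simp add: topspace_cone_topology point_mass_nonneg)
      from continuous_map_compose[OF this conv_continuous] show ?thesis by (simp add: o_def)
    qed
    moreover have "openin cone_topology ?S"
      by (rule openin_cone_topology_integral) (use f in auto)
    ultimately have "openin cone_topology {\<rho> \<in> topspace cone_topology. conv \<rho> ?z \<in> ?S}"
      by (rule openin_continuous_map_preimage)
    moreover have "point_mass u \<in> {\<rho> \<in> topspace cone_topology. conv \<rho> ?z \<in> ?S}"
      using pos \<tau> by (simp add: topspace_cone_topology point_mass_nonneg)
    ultimately obtain V where V: "open V" "u \<in> V"
        "cmeasure (uniform_measure ?M V) \<in> {\<rho> \<in> topspace cone_topology. conv \<rho> ?z \<in> ?S}"
      using normalized_restriction_tends_to_point_mass[OF rad fin u point_mass_nonneg, of _ "{\<rho> \<in> topspace cone_topology. conv \<rho> ?z \<in> ?S}"]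
      by blast
    let ?\<rho> = "conv (cmeasure (uniform_measure ?M V)) ?z"
    have \<rho>: "?\<rho> \<in> nonneg_radon_measures" and int: "0 < (LINT x|to_measure ?\<rho>. f x)"
      using V(3) by auto
    have "?\<rho> (- {x}) = 0"
      by (rule conv_normalized_restriction_null[OF rad fin])
         (use V u in \<open>auto simp: cmeasure_to_measure[OF \<mu>] cancel point_mass_def\<close>)
    then have "emeasure (to_measure ?\<rho>) (- {x}) = 0"
      by (simp add: measure_to_measure[OF \<rho>])
    then have "AE y in to_measure ?\<rho>. f y = 0"
      using f(5) by (intro AE_I[of _ _ "- {x}"]) (auto simp: sets_to_measure[OF \<rho>])
    then have "(LINT x|to_measure ?\<rho>. f x) = 0"
      by (rule integral_eq_zero_AE)
    with int show False by simp
  qed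
  have "(SUP C\<in>{C. compact C \<and> C \<subseteq> - {x}}. emeasure ?T C) \<le> 0"
    by (rule SUP_least) (use null in auto)
  then have "emeasure ?T (- {x}) = 0"
    using radon_measure_inner_regular[OF radon_measure_to_measure[OF \<tau>], of "- {x}"]
    by (metis closed_singleton le_zero_eq open_Compl)
  then have m0: "measure ?T (- {x}) = 0" by (simp add: measure_def)
  have "?\<tau> = point_mass x"
  proof
    fix A
    have cm: "?\<tau> A = complex_of_real (measure ?T A)"
      using cmeasure_to_measure[OF \<tau>] by (metis cmeasure_def)
    have one: "measure ?T UNIV = 1"
      using measure_to_measure[OF \<tau>] point_conv_prob(2)[of u "invol z"] by simp
    have zero: "measure ?T B = 0" if "x \<notin> B" for B
    proof -
      have "measure ?T B \<le> measure ?T (- {x})"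
        using that sT by (intro T.finite_measure_mono) auto
      then show ?thesis using m0 measure_nonneg[of ?T B] by linarith
    qed
    show "?\<tau> A = point_mass x A"
    proof (cases "A \<in> sets borel \<and> x \<in> A")
      case True
      have "measure ?T (UNIV - A) = measure ?T UNIV - measure ?T A"
        using True sT by (intro T.finite_measure_Diff) auto
      with True one zero[of "UNIV - A"] show ?thesis by (simp add: cm point_mass_def)
    next
      \<comment> \<open>This covers both \<open>x \<notin> A\<close> and non-Borel \<open>A\<close>;
        on non-Borel sets both sides are 0 by convention.\<close>
      case False
      then have "measure ?T A = 0" using zero sT measure_notin_sets by blast
      with False show ?thesis by (auto simp: cm point_mass_def)
    qed
  qed
  then have "?\<mu> = conv ?\<tau> (point_mass z)" by simp
  also have "\<dots> = point_mass u"
    using conv_assoc[OF point_mass_radon point_mass_radon point_mass_radon, of u "invol z" z]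
    by (simp add: cz unit)
  finally show thesis by (rule that)
qed

end

lemma integrable_Cc:
  fixes f :: "'a::t2_space \<Rightarrow> real"
  assumes rad: "radon_measure m" and f: "f \<in> Cc" "\<And>x. 0 \<le> f x" "\<And>x. f x \<le> 1"
  shows "integrable m f"
proof (rule integrableI_bounded)
  let ?K = "closure {x. f x \<noteq> 0}"
  have s: "sets m = sets borel" by (rule radon_measure_sets) fact
  have K: "compact ?K" and cont: "continuous_on UNIV f" using f(1) by (auto simp: Cc_def)
  show "f \<in> borel_measurable m"
    using borel_measurable_continuous_onI[OF cont] s by (simp cong: measurable_cong_sets)
  have "(\<integral>\<^sup>+x. ennreal (norm (f x)) \<partial>m) \<le> (\<integral>\<^sup>+x. indicator ?K x \<partial>m)"
  proof (rule nn_integral_mono)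
    fix x
    show "ennreal (norm (f x)) \<le> indicator ?K x"
      using f(2,3)[of x] closure_subset[of "{x. f x \<noteq> 0}"]
      by (cases "f x = 0") (auto simp: indicator_def)
  qed
  also have "\<dots> = emeasure m ?K" using s by simp
  also have "\<dots> < \<infinity>" by (rule radon_measure_compact_finite[OF rad K])
  finally show "(\<integral>\<^sup>+x. ennreal (norm (f x)) \<partial>m) < \<infinity>" .
qed

section \<open>Central translations as homeomorphisms\<close>

context hypergroup
begin

lemma invol_center: "z \<in> hg_center conv invol e \<Longrightarrow> invol z \<in> hg_center conv invol e"
  by (simp add: hg_center_def invol_invol)

lemma
  assumes "z \<in> hg_center conv invol e"
  shows supp_conv_center: "supp (conv (point_mass x) (point_mass z)) = {hg_mult conv x z}"
    and conv_center: "conv (point_mass x) (point_mass z) = point_mass (hg_mult conv x z)"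
proof -
  obtain u where "conv (point_mass x) (point_mass z) = point_mass u"
    by (rule central_conv_point_mass[OF assms])
  then show "supp (conv (point_mass x) (point_mass z)) = {hg_mult conv x z}"
    and "conv (point_mass x) (point_mass z) = point_mass (hg_mult conv x z)"
    by (simp_all add: hg_mult_def supp_point_mass[OF point_mass_nonneg])
qed

lemma hg_mult_invol:
  assumes z: "z \<in> hg_center conv invol e"
  shows "hg_mult conv (hg_mult conv x z) (invol z) = x"
proof (rule point_mass_inject)
  have "point_mass (hg_mult conv (hg_mult conv x z) (invol z)) =
      conv (conv (point_mass x) (point_mass z)) (point_mass (invol z))"
    by (simp add: conv_center z invol_center)
  also have "\<dots> = conv (point_mass x) (conv (point_mass z) (point_mass (invol z)))"
    by (rule conv_assoc[OF point_mass_radon point_mass_radon point_mass_radon])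
  also have "\<dots> = point_mass x"
    using z by (simp add: hg_center_def unit)
  finally show "point_mass (hg_mult conv (hg_mult conv x z) (invol z)) = point_mass x" .
qed

lemma hg_mult_invol':
  assumes z: "z \<in> hg_center conv invol e"
  shows "hg_mult conv (hg_mult conv x (invol z)) z = x"
  using hg_mult_invol[OF invol_center[OF z], of x] by (simp add: invol_invol)

text \<open>The supports are singletons here, so "the support meets \<open>U\<close>" means that the
  translate lies in \<open>U\<close>, and continuity of the support map in the Michael topology
  becomes ordinary continuity.\<close>

lemma continuous_on_hg_mult:
  assumes z: "z \<in> hg_center conv invol e"
  shows "continuous_on UNIV (\<lambda>x. hg_mult conv x z)"
proof -
  have "open ((\<lambda>x. hg_mult conv x z) -` U)" if U: "open U" for U
  proof -
    let ?S = "{C. compact C \<and> C \<noteq> {} \<and> C \<inter> U \<noteq> {} \<and> C \<subseteq> UNIV}"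
    have "openin michael_topology ?S"
      unfolding michael_topology_def
      by (rule topology_generated_by_Basis) (use U open_UNIV in blast)
    then have "openin euclidean {p \<in> topspace euclidean.
        (case p of (x, y) \<Rightarrow> supp (conv (point_mass x) (point_mass y))) \<in> ?S}"
      by (rule openin_continuous_map_preimage[OF supp_continuous])
    then have "open {p. (case p of (x, y) \<Rightarrow> supp (conv (point_mass x) (point_mass y))) \<in> ?S}"
      by simp
    moreover have "continuous_on UNIV (\<lambda>x. (x, z))" by (intro continuous_intros)
    ultimately have "open ((\<lambda>x. (x, z)) -`
        {p. (case p of (x, y) \<Rightarrow> supp (conv (point_mass x) (point_mass y))) \<in> ?S})"
      by (rule open_vimage)
    moreover have "(\<lambda>x. (x, z)) -`
        {p. (case p of (x, y) \<Rightarrow> supp (conv (point_mass x) (point_mass y))) \<in> ?S} =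
        (\<lambda>x. hg_mult conv x z) -` U"
      by (auto simp: supp_conv_center[OF z])
    ultimately show ?thesis by simp
  qed
  then show ?thesis by (simp add: continuous_on_open_vimage)
qed

lemma measurable_hg_mult:
  assumes "z \<in> hg_center conv invol e"
  shows "(\<lambda>x. hg_mult conv x z) \<in> borel \<rightarrow>\<^sub>M borel"
  by (rule borel_measurable_continuous_onI[OF continuous_on_hg_mult[OF assms]])

lemma hg_eval_center:
  fixes f :: "'a \<Rightarrow> 'b::{banach,second_countable_topology}"
  assumes "z \<in> hg_center conv invol e" "f \<in> borel_measurable borel"
  shows "hg_eval conv f x z = f (hg_mult conv x z)"
  unfolding hg_eval_def conv_center[OF assms(1)]
  by (rule integral_point_mass[OF point_mass_nonneg assms(2)])

section \<open>Invariance of the Haar measure under central translations\<close>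

lemma vimage_hg_mult_eq_image:
  assumes z: "z \<in> hg_center conv invol e"
  shows "(\<lambda>x. hg_mult conv x z) -` A = (\<lambda>x. hg_mult conv x (invol z)) ` A"
  by (force simp: hg_mult_invol[OF z] hg_mult_invol'[OF z] image_iff)

text \<open>Invariance is given only for functions in \<open>Cc\<close>. For compact
  \<open>C\<close> inside \<open>U\<close>, a cutoff \<open>f\<close> between the indicators of
  \<open>C\<close> and \<open>U\<close> has the same integral as its translate, which is bounded by
  the indicator of the preimage of \<open>U\<close>. Inner regularity then takes the supremum over
  \<open>C\<close>.\<close>

lemma haar_open_le:
  assumes haar: "right_haar_measure conv m" and z: "z \<in> hg_center conv invol e" and U: "open U"
  shows "emeasure m U \<le> emeasure m ((\<lambda>x. hg_mult conv x z) -` U)"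
proof -
  let ?T = "\<lambda>x. hg_mult conv x z"
  have rad: "radon_measure m" using haar by (simp add: right_haar_measure_def)
  have s: "sets m = sets borel" by (rule radon_measure_sets) fact
  have TU: "open (?T -` U)" using U by (rule open_vimage) (rule continuous_on_hg_mult[OF z])
  have "emeasure m C \<le> emeasure m (?T -` U)" if C: "compact C" "C \<subseteq> U" for C
  proof -
    obtain f :: "'a \<Rightarrow> real" where f: "f \<in> Cc" "\<And>x. 0 \<le> f x" "\<And>x. f x \<le> 1"
      "\<And>x. x \<in> C \<Longrightarrow> f x = 1" "\<And>x. x \<notin> U \<Longrightarrow> f x = 0"
      by (rule Urysohn_compact_support[OF locally_compact C(1) U C(2)]) blast
    have cf: "continuous_on UNIV f" using f(1) by (simp add: Cc_def)
    have cT: "continuous_on UNIV (\<lambda>x. f (?T x))"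
      using continuous_on_compose2[OF cf continuous_on_hg_mult[OF z]] by simp
    have "f \<circ> ?T \<in> Cc"
    proof -
      let ?K = "closure {x. f x \<noteq> 0}"
      have "compact (?T -` ?K)"
        unfolding vimage_hg_mult_eq_image[OF z]
        using f(1) continuous_on_subset[OF continuous_on_hg_mult[OF invol_center[OF z]]]
        by (intro compact_continuous_image) (auto simp: Cc_def)
      moreover have "closure {x. (f \<circ> ?T) x \<noteq> 0} \<subseteq> ?T -` ?K"
      proof (rule closure_minimal)
        show "{x. (f \<circ> ?T) x \<noteq> 0} \<subseteq> ?T -` ?K" using closure_subset by fastforce
        show "closed (?T -` ?K)"
          by (rule closed_vimage[OF closed_closure continuous_on_hg_mult[OF z]])
      qed
      ultimately have "compact (closure {x. (f \<circ> ?T) x \<noteq> 0})"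
        by (metis closed_closure compact_Int_closed inf.absorb2)
      with cT show ?thesis by (simp add: Cc_def o_def)
    qed
    \<comment> \<open>Integrability of \<open>f\<close> and of its translate lets the equality of
      Bochner integrals pass to non-negative integrals; a non-integrable function would have Bochner
      integral 0 by default.\<close>
    then have iT: "integrable m (\<lambda>x. f (?T x))"
      using integrable_Cc[OF rad, of "f \<circ> ?T"] f(2,3) by (simp add: o_def)
    have i: "integrable m f" by (rule integrable_Cc[OF rad f(1,2,3)])
    let ?g = "\<lambda>x. complex_of_real (f x)"
    have g: "?g \<in> Cc" using f(1) by (auto simp: Cc_def intro: continuous_intros)
    have "(LINT y|m. hg_eval conv ?g y z) = (LINT y|m. ?g y)"
      using haar g by (simp add: right_haar_measure_def)
    moreover have "hg_eval conv ?g y z = complex_of_real (f (?T y))" for y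
      using g by (subst hg_eval_center[OF z]) (auto simp: Cc_def intro: borel_measurable_continuous_onI)
    ultimately have eq: "(LINT y|m. f (?T y)) = (LINT y|m. f y)"
      by simp
    have "emeasure m C = (\<integral>\<^sup>+x. indicator C x \<partial>m)"
      using C s by (simp add: borel_compact)
    also have "\<dots> \<le> (\<integral>\<^sup>+x. ennreal (f x) \<partial>m)"
      by (rule nn_integral_mono) (use f in \<open>auto simp: indicator_def\<close>)
    also have "\<dots> = (\<integral>\<^sup>+x. ennreal (f (?T x)) \<partial>m)"
      using nn_integral_eq_integral[OF i] nn_integral_eq_integral[OF iT] f(2) eq by simp
    also have "\<dots> \<le> (\<integral>\<^sup>+x. indicator (?T -` U) x \<partial>m)"
      by (rule nn_integral_mono) (use f in \<open>auto simp: indicator_def\<close>)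
    also have "\<dots> = emeasure m (?T -` U)"
      using TU s by simp
    finally show ?thesis .
  qed
  then have "(SUP C\<in>{C. compact C \<and> C \<subseteq> U}. emeasure m C) \<le> emeasure m (?T -` U)"
    by (intro SUP_least) auto
  then show ?thesis
    by (simp only: radon_measure_inner_regular[OF rad U, symmetric])
qed

text \<open>The reverse inequality is \<open>haar_open_le\<close> for the inverse translation,
  applied to the preimage of \<open>U\<close>. The same device gives equality for Borel sets in
  \<open>distr_haar_hg_mult\<close>.\<close>

lemma haar_open_eq:
  assumes haar: "right_haar_measure conv m" and z: "z \<in> hg_center conv invol e" and U: "open U"
  shows "emeasure m ((\<lambda>x. hg_mult conv x z) -` U) = emeasure m U"
proof (rule antisym)
  have "open ((\<lambda>x. hg_mult conv x z) -` U)"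
    using U by (rule open_vimage) (rule continuous_on_hg_mult[OF z])
  from haar_open_le[OF haar invol_center[OF z] this]
  show "emeasure m ((\<lambda>x. hg_mult conv x z) -` U) \<le> emeasure m U"
    by (simp add: vimage_def hg_mult_invol'[OF z])
qed (rule haar_open_le[OF haar z U])

lemma haar_borel_le:
  assumes haar: "right_haar_measure conv m" and z: "z \<in> hg_center conv invol e" and A: "A \<in> sets borel"
  shows "emeasure m ((\<lambda>x. hg_mult conv x z) -` A) \<le> emeasure m A"
proof -
  have rad: "radon_measure m" using haar by (simp add: right_haar_measure_def)
  have s: "sets m = sets borel" by (rule radon_measure_sets) fact
  have "emeasure m ((\<lambda>x. hg_mult conv x z) -` A) \<le> emeasure m U" if U: "open U" "A \<subseteq> U" for U
  proof -
    have "open ((\<lambda>x. hg_mult conv x z) -` U)"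
      using U(1) by (rule open_vimage) (rule continuous_on_hg_mult[OF z])
    then have "emeasure m ((\<lambda>x. hg_mult conv x z) -` A) \<le> emeasure m ((\<lambda>x. hg_mult conv x z) -` U)"
      using U s by (intro emeasure_mono) auto
    then show ?thesis by (simp add: haar_open_eq[OF haar z U(1)])
  qed
  then have "emeasure m ((\<lambda>x. hg_mult conv x z) -` A) \<le> (INF U\<in>{U. open U \<and> A \<subseteq> U}. emeasure m U)"
    by (intro INF_greatest) auto
  then show ?thesis
    by (simp only: radon_measure_outer_regular[OF rad A, symmetric])
qed

lemma vimage_hg_mult_borel:
  assumes "z \<in> hg_center conv invol e" "A \<in> sets borel"
  shows "(\<lambda>x. hg_mult conv x z) -` A \<in> sets borel"
  using measurable_sets[OF measurable_hg_mult[OF assms(1)] assms(2)] by simp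

lemma distr_haar_hg_mult:
  assumes haar: "right_haar_measure conv m" and z: "z \<in> hg_center conv invol e"
  shows "distr m m (\<lambda>x. hg_mult conv x z) = m"
proof (rule measure_eqI)
  have rad: "radon_measure m" using haar by (simp add: right_haar_measure_def)
  have s: "sets m = sets borel" by (rule radon_measure_sets) fact
  have T: "(\<lambda>x. hg_mult conv x z) \<in> m \<rightarrow>\<^sub>M m"
    using measurable_hg_mult[OF z] measurable_cong_sets[OF s s] by auto
  fix A assume "A \<in> sets (distr m m (\<lambda>x. hg_mult conv x z))"
  then have A: "A \<in> sets borel" using s by simp
  have "emeasure m ((\<lambda>x. hg_mult conv x z) -` A) = emeasure m A"
  proof (rule antisym)
    show "emeasure m ((\<lambda>x. hg_mult conv x z) -` A) \<le> emeasure m A"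
      by (rule haar_borel_le[OF haar z A])
    show "emeasure m A \<le> emeasure m ((\<lambda>x. hg_mult conv x z) -` A)"
      using haar_borel_le[OF haar invol_center[OF z] vimage_hg_mult_borel[OF z A]]
      by (simp add: vimage_def hg_mult_invol'[OF z])
  qed
  then show "emeasure (distr m m (\<lambda>x. hg_mult conv x z)) A = emeasure m A"
    using T A s by (simp add: emeasure_distr space_eq_UNIV_of_sets_borel[OF s])
qed simp

end

section \<open>The Orlicz norm\<close>

text \<open>A monotone function has intervals as superlevel sets. Composing with
  \<open>max 0\<close> extends monotonicity from \<open>{0..}\<close> to the whole line without
  changing values at norms.\<close>

lemma borel_measurable_complementary_cmod:
  assumes mono: "mono_on {0..} (complementary \<Phi>)" and v: "v \<in> borel_measurable M"
  shows "(\<lambda>x. complementary \<Phi> (cmod (v x))) \<in> borel_measurable M"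
proof -
  let ?g = "\<lambda>y::real. complementary \<Phi> (max 0 y)"
  have "?g \<in> borel_measurable borel"
  proof (rule borel_measurableI_greater)
    fix b
    have "?g x \<le> ?g y" if "x \<le> y" for x y
      using mono that by (auto simp: mono_on_def)
    then have "is_interval {y. b < ?g y}"
      by (auto simp: is_interval_1 intro: less_le_trans)
    then show "{y \<in> space borel. b < ?g y} \<in> sets borel"
      using real_interval_borel_measurable by simp
  qed
  moreover have "(\<lambda>x. cmod (v x)) \<in> borel_measurable M" using v by simp
  ultimately have "(\<lambda>x. ?g (cmod (v x))) \<in> borel_measurable M" by (rule measurable_compose[rotated])
  then show ?thesis by simp
qed

lemma orlicz_norm_mono:
  assumes "\<And>x. cmod (f x) \<le> cmod (g x)"
  shows "orlicz_norm \<Phi> m f \<le> orlicz_norm \<Phi> m g"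
  unfolding orlicz_norm_def
  by (intro SUP_mono' nn_integral_mono ennreal_leI) (simp add: norm_mult mult_right_mono assms)

lemma orlicz_norm_cong:
  assumes "\<And>x. cmod (f x) = cmod (g x)"
  shows "orlicz_norm \<Phi> m f = orlicz_norm \<Phi> m g"
  by (intro antisym orlicz_norm_mono) (simp_all add: assms)

lemma orlicz_norm_cmult:
  assumes s: "sets m = sets borel" and f: "f \<in> borel_measurable borel"
  shows "orlicz_norm \<Phi> m (\<lambda>x. c * f x) = ennreal (cmod c) * orlicz_norm \<Phi> m f"
proof -
  have "(\<integral>\<^sup>+x. ennreal (cmod (c * f x * v x)) \<partial>m) = ennreal (cmod c) * (\<integral>\<^sup>+x. ennreal (cmod (f x * v x)) \<partial>m)"
    if "v \<in> borel_measurable borel" for v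
  proof -
    have "(\<lambda>x. ennreal (cmod (f x * v x))) \<in> borel_measurable borel" using f that by measurable
    then have "(\<lambda>x. ennreal (cmod (f x * v x))) \<in> borel_measurable m"
      using measurable_cong_sets[OF s refl] by auto
    then show ?thesis
      by (subst nn_integral_cmult[symmetric]) (auto simp: norm_mult ennreal_mult' mult.assoc)
  qed
  then show ?thesis
    unfolding orlicz_norm_def SUP_mult_left_ennreal by (intro SUP_cong) auto
qed

lemma orlicz_norm_add_le:
  assumes s: "sets m = sets borel" and f: "f \<in> borel_measurable borel" and g: "g \<in> borel_measurable borel"
  shows "orlicz_norm \<Phi> m (\<lambda>x. f x + g x) \<le> orlicz_norm \<Phi> m f + orlicz_norm \<Phi> m g"
  unfolding orlicz_norm_def[of _ _ "\<lambda>x. f x + g x"]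
proof (rule SUP_least)
  let ?V = "{v \<in> borel_measurable borel. (\<integral>\<^sup>+x. complementary \<Phi> (cmod (v x)) \<partial>m) \<le> 1}"
  fix v assume v: "v \<in> ?V"
  have meas: "(\<lambda>x. ennreal (cmod (h x * v x))) \<in> borel_measurable m" if "h \<in> borel_measurable borel" for h
  proof -
    have "v \<in> borel_measurable borel" using v by simp
    then have "(\<lambda>x. ennreal (cmod (h x * v x))) \<in> borel_measurable borel" using that by measurable
    then show ?thesis using measurable_cong_sets[OF s refl] by auto
  qed
  have "(\<integral>\<^sup>+x. ennreal (cmod ((f x + g x) * v x)) \<partial>m) \<le>
      (\<integral>\<^sup>+x. ennreal (cmod (f x * v x)) + ennreal (cmod (g x * v x)) \<partial>m)"
    by (rule nn_integral_mono)
       (simp add: ennreal_plus[symmetric] distrib_right norm_triangle_ineq del: ennreal_plus)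
  also have "\<dots> = (\<integral>\<^sup>+x. ennreal (cmod (f x * v x)) \<partial>m) + (\<integral>\<^sup>+x. ennreal (cmod (g x * v x)) \<partial>m)"
    by (rule nn_integral_add[OF meas[OF f] meas[OF g]])
  also have "\<dots> \<le> orlicz_norm \<Phi> m f + orlicz_norm \<Phi> m g"
    unfolding orlicz_norm_def by (intro add_mono SUP_upper v)
  finally show "(\<integral>\<^sup>+x. ennreal (cmod ((f x + g x) * v x)) \<partial>m) \<le> orlicz_norm \<Phi> m f + orlicz_norm \<Phi> m g" .
qed

lemma orlicz_norm_diff_commute:
  "orlicz_norm \<Phi> m (\<lambda>x. f x - g x) = orlicz_norm \<Phi> m (\<lambda>x. g x - f x)"
  by (rule orlicz_norm_cong) (rule norm_minus_commute)

lemma orlicz_norm_triangle: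
  assumes "sets m = sets borel" and "f \<in> borel_measurable borel" "g \<in> borel_measurable borel"
    "h \<in> borel_measurable borel"
  shows "orlicz_norm \<Phi> m (\<lambda>x. f x - h x) \<le>
    orlicz_norm \<Phi> m (\<lambda>x. f x - g x) + orlicz_norm \<Phi> m (\<lambda>x. g x - h x)"
  using orlicz_norm_add_le[OF assms(1), of "\<lambda>x. f x - g x" "\<lambda>x. g x - h x"] assms by simp

text \<open>Chebyshev's inequality for the Orlicz norm: \<open>\<epsilon>\<close> times the
  indicator of \<open>A\<close> is dominated by \<open>f\<close>. The bound
  \<open>\<epsilon> * \<epsilon>\<close> is chosen so that dividing by the level leaves
  \<open>\<epsilon>\<close>.\<close>

lemma orlicz_norm_indicator_level:
  assumes s: "sets m = sets borel" and A: "A \<in> sets borel" and "0 < \<epsilon>"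
    and level: "\<And>x. x \<in> A \<Longrightarrow> \<epsilon> \<le> cmod (f x)"
    and f: "orlicz_norm \<Phi> m f \<le> ennreal (\<epsilon> * \<epsilon>)"
  shows "orlicz_norm \<Phi> m (indicator A) \<le> ennreal \<epsilon>"
proof -
  have "ennreal \<epsilon> * orlicz_norm \<Phi> m (indicator A) = orlicz_norm \<Phi> m (\<lambda>x. complex_of_real \<epsilon> * indicator A x)"
    using A \<open>0 < \<epsilon>\<close> by (subst orlicz_norm_cmult[OF s]) auto
  also have "\<dots> \<le> orlicz_norm \<Phi> m f"
    using level \<open>0 < \<epsilon>\<close> by (intro orlicz_norm_mono) (auto simp: indicator_def)
  also have "\<dots> \<le> ennreal \<epsilon> * ennreal \<epsilon>"
    using f \<open>0 < \<epsilon>\<close> by (simp add: ennreal_mult)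
  finally show ?thesis
    using \<open>0 < \<epsilon>\<close> by (simp add: ennreal_mult_le_mult_iff)
qed

text \<open>Change of variables moves the translation from \<open>f\<close> to the test function:
  \<open>v\<close> becomes the composite of \<open>v\<close> with \<open>S\<close>, which satisfies
  the same constraint because \<open>S\<close> preserves \<open>m\<close>.\<close>

lemma orlicz_norm_compose_le:
  assumes s: "sets m = sets borel" and mono: "mono_on {0..} (complementary \<Phi>)"
    and T: "T \<in> borel \<rightarrow>\<^sub>M borel" "distr m m T = m"
    and S: "S \<in> borel \<rightarrow>\<^sub>M borel" "distr m m S = m"
    and inv: "\<And>x. S (T x) = x" and f: "f \<in> borel_measurable borel"
  shows "orlicz_norm \<Phi> m (\<lambda>x. f (T x)) \<le> orlicz_norm \<Phi> m f"
  unfolding orlicz_norm_def[of _ _ "\<lambda>x. f (T x)"]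
proof (rule SUP_least)
  let ?V = "{v \<in> borel_measurable borel. (\<integral>\<^sup>+x. complementary \<Phi> (cmod (v x)) \<partial>m) \<le> 1}"
  fix v assume v: "v \<in> ?V"
  have TS: "T \<in> m \<rightarrow>\<^sub>M m" "S \<in> m \<rightarrow>\<^sub>M m"
    using T(1) S(1) measurable_cong_sets[OF s s] by auto
  have vS: "(\<lambda>x. v (S x)) \<in> borel_measurable borel"
    using v by (intro measurable_compose[OF S(1)]) auto
  have "(\<lambda>x. ennreal (cmod (f x * v (S x)))) \<in> borel_measurable borel"
    using f vS by measurable
  then have m1: "(\<lambda>x. ennreal (cmod (f x * v (S x)))) \<in> borel_measurable (distr m m T)"
    using measurable_cong_sets[OF s refl] T(2) by auto
  have vm: "v \<in> borel_measurable m" using v measurable_cong_sets[OF s refl] by auto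
  have m2: "(\<lambda>x. complementary \<Phi> (cmod (v x))) \<in> borel_measurable (distr m m S)"
    unfolding S(2) by (rule borel_measurable_complementary_cmod[OF mono vm])
  have "(\<integral>\<^sup>+x. complementary \<Phi> (cmod (v (S x))) \<partial>m) = (\<integral>\<^sup>+x. complementary \<Phi> (cmod (v x)) \<partial>m)"
    using nn_integral_distr[OF TS(2) m2] by (simp add: S(2))
  with v vS have vS': "(\<lambda>x. v (S x)) \<in> ?V" by simp
  have "(\<integral>\<^sup>+x. ennreal (cmod (f (T x) * v x)) \<partial>m) = (\<integral>\<^sup>+x. ennreal (cmod (f x * v (S x))) \<partial>m)"
    using nn_integral_distr[OF TS(1) m1] by (simp add: T(2) inv)
  also have "\<dots> \<le> orlicz_norm \<Phi> m f"
    unfolding orlicz_norm_def by (rule SUP_upper2[OF vS']) simp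
  finally show "(\<integral>\<^sup>+x. ennreal (cmod (f (T x) * v x)) \<partial>m) \<le> orlicz_norm \<Phi> m f" .
qed

section \<open>Young functions, their complements and norms of indicators\<close>

lemma increasing_complementary_finite_value:
  assumes inc: "increasing_complementary \<Phi>" and "\<Phi> 0 = 0"
  shows "\<exists>x>0. \<Phi> x < \<infinity>"
proof (rule ccontr)
  assume "\<not> (\<exists>x>0. \<Phi> x < \<infinity>)"
  then have inf: "\<Phi> x = \<infinity>" if "0 < x" for x
    using that by (metis infinity_ennreal_def top.not_eq_extremum)
  \<comment> \<open>Every term of the supremum with \<open>x > 0\<close> is minus infinity and the
    term at \<open>x = 0\<close> is 0, so the complementary function would be constant.\<close>
  have "complementary \<Phi> y = 0" for y
  proof -
    have "(SUP x\<in>{0..}. ereal (x * y) - enn2ereal (\<Phi> x)) \<le> 0"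
    proof (rule SUP_least)
      fix x :: real assume "x \<in> {0..}"
      then show "ereal (x * y) - enn2ereal (\<Phi> x) \<le> 0"
        using inf[of x] assms(2) by (cases "x = 0") (auto simp: zero_ennreal.rep_eq)
    qed
    then have "complementary \<Phi> y \<le> e2ennreal 0"
      unfolding complementary_def by (rule e2ennreal_mono)
    then show ?thesis by (metis zero_ereal_def e2ennreal_ereal ennreal_0 le_zero_eq)
  qed
  then have "complementary \<Phi> constant_on {0..}" by (auto simp: constant_on_def)
  with inc show False by (simp add: increasing_complementary_def)
qed

lemma young_inequality:
  assumes "0 \<le> x"
  shows "ennreal (x * y) \<le> \<Phi> x + complementary \<Phi> y"
proof (cases "\<Phi> x")
  case (real r)
  have "ereal (x * y - r) \<le> (SUP x\<in>{0..}. ereal (x * y) - enn2ereal (\<Phi> x))"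
    using assms real by (intro SUP_upper2[of x]) (auto simp: enn2ereal_ennreal)
  then have "e2ennreal (ereal (x * y - r)) \<le> complementary \<Phi> y"
    unfolding complementary_def by (rule e2ennreal_mono)
  then have "ennreal (x * y - r) \<le> complementary \<Phi> y" by (simp add: e2ennreal_ereal)
  \<comment> \<open>The map \<open>ennreal\<close> sends negative numbers to 0, so the inequality is
    checked separately when \<open>x * y \<le> r\<close>.\<close>
  moreover have "ennreal (x * y) \<le> ennreal r + ennreal (x * y - r)"
  proof (cases "x * y \<le> r")
    case True
    then show ?thesis by (simp add: ennreal_leI add_increasing2)
  next
    case False
    then show ?thesis using real by (simp add: ennreal_plus[symmetric] del: ennreal_plus)
  qed
  ultimately show ?thesis using real by (metis add_left_mono order_trans)
qed simp

text \<open>Supplies admissible test functions with small values. Convexity and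
  \<open>\<Phi> 0 = 0\<close> give \<open>\<Phi> x \<ge> (p / b) * x\<close> for
  \<open>x \<ge> b\<close>, so for \<open>y \<le> p / b\<close> such \<open>x\<close> contribute
  nothing positive to the supremum, while \<open>x < b\<close> contributes at most
  \<open>b * y\<close>.\<close>

lemma complementary_linear_bound:
  assumes young: "young_function \<Phi>"
  obtains b c where "0 < b" "0 < c" "\<And>y. 0 \<le> y \<Longrightarrow> y \<le> c \<Longrightarrow> complementary \<Phi> y \<le> ennreal (b * y)"
proof -
  obtain b where b: "b \<ge> 0" "\<Phi> b \<noteq> 0" using young by (auto simp: young_function_def)
  have "\<Phi> 0 = 0" using young by (simp add: young_function_def)
  then have "b \<noteq> 0" using b(2) by auto
  then have "0 < b" using b by simp
  \<comment> \<open>A finite positive lower bound for \<open>\<Phi> b\<close>, which may itself be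
    infinite.\<close>
  obtain p where p: "0 < p" "ennreal p \<le> \<Phi> b"
  proof (cases "\<Phi> b")
    case (real r)
    then show ?thesis using b(2) that[of r] by (simp add: order.order_iff_strict)
  next
    case top
    then show ?thesis using that[of 1] by simp
  qed
  have convex: "\<Phi> (t * x + (1 - t) * y) \<le> ennreal t * \<Phi> x + ennreal (1 - t) * \<Phi> y"
    if "0 \<le> x" "0 \<le> y" "0 \<le> t" "t \<le> 1" for x y t
    using young that by (simp add: young_function_def)
  have bound: "ennreal (p / b * x) \<le> \<Phi> x" if "b \<le> x" for x
  proof -
    have x: "0 < x" using that \<open>0 < b\<close> by simp
    have "ennreal p \<le> \<Phi> b" by fact
    also have "\<dots> \<le> ennreal (b / x) * \<Phi> x"
      using convex[of x 0 "b / x"] x that \<open>0 < b\<close> \<open>\<Phi> 0 = 0\<close> by simp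
    finally have "ennreal (x / b) * ennreal p \<le> ennreal (x / b) * (ennreal (b / x) * \<Phi> x)"
      by (rule mult_left_mono) simp
    also have "\<dots> = ennreal (x / b * (b / x)) * \<Phi> x"
      using x \<open>0 < b\<close> by (subst ennreal_mult) (auto simp: mult.assoc)
    also have "\<dots> = \<Phi> x" using x \<open>0 < b\<close> by simp
    finally show ?thesis
      using x \<open>0 < b\<close> p(1) by (simp add: ennreal_mult[symmetric] mult.commute)
  qed
  show thesis
  proof (rule that[of b "p / b"])
    fix y :: real assume y: "0 \<le> y" "y \<le> p / b"
    have "(SUP x\<in>{0..}. ereal (x * y) - enn2ereal (\<Phi> x)) \<le> ereal (b * y)"
    proof (rule SUP_least)
      fix x :: real assume "x \<in> {0..}"
      then have x: "0 \<le> x" by simp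
      show "ereal (x * y) - enn2ereal (\<Phi> x) \<le> ereal (b * y)"
      proof (cases "\<Phi> x")
        case (real r)
        have "x * y - r \<le> b * y"
        proof (cases "b \<le> x")
          case True
          have "ennreal (p / b * x) \<le> ennreal r" using bound[OF True] real by simp
          then have "p / b * x \<le> r" using real by (simp add: ennreal_le_iff)
          moreover have "x * y \<le> x * (p / b)" using y x by (intro mult_left_mono) auto
          moreover have "0 \<le> b * y" using \<open>0 < b\<close> y by simp
          ultimately show ?thesis by (simp add: mult.commute)
        next
          case False
          then have "x * y \<le> b * y" using y by (intro mult_right_mono) auto
          then show ?thesis using real by simp
        qed
        then show ?thesis using real by (simp add: enn2ereal_ennreal)
      qed simp
    qed
    then have "complementary \<Phi> y \<le> e2ennreal (ereal (b * y))"
      unfolding complementary_def by (rule e2ennreal_mono)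
    then show "complementary \<Phi> y \<le> ennreal (b * y)" by (simp add: e2ennreal_ereal)
  qed (use \<open>0 < b\<close> p in auto)
qed

text \<open>Fix \<open>x > 0\<close> with \<open>\<Phi> x\<close> finite and integrate Young's
  inequality for \<open>x\<close> and the modulus of \<open>v\<close> over \<open>E\<close>; the
  constraint on \<open>v\<close> bounds the complementary part by 1.\<close>

lemma orlicz_norm_indicator_finite:
  assumes s: "sets m = sets borel" and inc: "increasing_complementary \<Phi>" and "\<Phi> 0 = 0"
    and E: "E \<in> sets borel" "emeasure m E < \<infinity>"
  shows "orlicz_norm \<Phi> m (indicator E) < \<infinity>"
proof -
  obtain x where x: "0 < x" "\<Phi> x < \<infinity>"
    using increasing_complementary_finite_value[OF inc \<open>\<Phi> 0 = 0\<close>] by blast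
  have mono: "mono_on {0..} (complementary \<Phi>)" using inc by (simp add: increasing_complementary_def)
  let ?K = "ennreal (1 / x) * (\<Phi> x * emeasure m E + 1)"
  have "orlicz_norm \<Phi> m (indicator E) \<le> ?K"
    unfolding orlicz_norm_def
  proof (rule SUP_least)
    fix v :: "'a \<Rightarrow> complex"
    assume v: "v \<in> {v \<in> borel_measurable borel. (\<integral>\<^sup>+x. complementary \<Phi> (cmod (v x)) \<partial>m) \<le> 1}"
    have vm: "v \<in> borel_measurable m" using v measurable_cong_sets[OF s refl] by auto
    note mv = borel_measurable_complementary_cmod[OF mono vm]
    have "(\<integral>\<^sup>+y. ennreal (cmod (indicator E y * v y)) \<partial>m) \<le>
        (\<integral>\<^sup>+y. ennreal (1 / x) * (\<Phi> x * indicator E y + complementary \<Phi> (cmod (v y))) \<partial>m)"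
    proof (rule nn_integral_mono)
      fix y
      show "ennreal (cmod (indicator E y * v y)) \<le>
        ennreal (1 / x) * (\<Phi> x * indicator E y + complementary \<Phi> (cmod (v y)))"
      proof (cases "y \<in> E")
        case True
        have "ennreal (cmod (v y)) = ennreal (1 / x) * ennreal (x * cmod (v y))"
          using x(1) by (subst ennreal_mult[symmetric]) auto
        also have "\<dots> \<le> ennreal (1 / x) * (\<Phi> x + complementary \<Phi> (cmod (v y)))"
          using x(1) by (intro mult_left_mono young_inequality) auto
        finally show ?thesis using True by simp
      qed simp
    qed
    also have "\<dots> = ennreal (1 / x) * (\<integral>\<^sup>+y. \<Phi> x * indicator E y + complementary \<Phi> (cmod (v y)) \<partial>m)"
      using mv E s by (intro nn_integral_cmult) auto
    also have "(\<integral>\<^sup>+y. \<Phi> x * indicator E y + complementary \<Phi> (cmod (v y)) \<partial>m) =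
        \<Phi> x * emeasure m E + (\<integral>\<^sup>+y. complementary \<Phi> (cmod (v y)) \<partial>m)"
      using mv E s by (subst nn_integral_add) (auto simp: nn_integral_cmult_indicator)
    also have "ennreal (1 / x) * (\<Phi> x * emeasure m E + (\<integral>\<^sup>+y. complementary \<Phi> (cmod (v y)) \<partial>m)) \<le> ?K"
      using v by (intro mult_left_mono add_left_mono) auto
    finally show "(\<integral>\<^sup>+y. ennreal (cmod (indicator E y * v y)) \<partial>m) \<le> ?K" .
  qed
  also have "?K < \<infinity>"
    using x E by (simp add: ennreal_mult_less_top)
  finally show ?thesis .
qed

lemma orlicz_norm_indicator_pos:
  assumes s: "sets m = sets borel" and young: "young_function \<Phi>"
    and E: "E \<in> sets borel" "emeasure m E < \<infinity>" "emeasure m E > 0"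
  shows "orlicz_norm \<Phi> m (indicator E) > 0"
proof -
  obtain b c where bc: "0 < b" "0 < c"
    and le: "\<And>y. 0 \<le> y \<Longrightarrow> y \<le> c \<Longrightarrow> complementary \<Phi> y \<le> ennreal (b * y)"
    by (rule complementary_linear_bound[OF young]) blast
  obtain k where k: "emeasure m E = ennreal k" "0 < k"
    using E(2,3) by (cases "emeasure m E") auto
  \<comment> \<open>The height of the test function: at most \<open>c\<close> for the linear bound
    to apply, and at most \<open>1 / (b * k)\<close> so that the constraint integral is at most
    1.\<close>
  define y where "y = min c (1 / (b * k))"
  have y: "0 < y" "y \<le> c" "b * y * k \<le> 1"
    using bc k by (auto simp: y_def min_def field_simps)
  let ?v = "\<lambda>x. complex_of_real y * indicator E x"
  have "(\<integral>\<^sup>+x. complementary \<Phi> (cmod (?v x)) \<partial>m) \<le> (\<integral>\<^sup>+x. ennreal (b * y) * indicator E x \<partial>m)"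
    \<comment> \<open>The instance at 0 handles points off \<open>E\<close>, where the complementary
      function vanishes.\<close>
    using y le[of y] le[of 0] bc by (intro nn_integral_mono) (auto simp: indicator_def)
  also have "\<dots> = ennreal (b * y * k)"
    using E s bc y k by (simp add: nn_integral_cmult_indicator ennreal_mult)
  also have "\<dots> \<le> 1" using y by (simp add: ennreal_le_1)
  finally have "?v \<in> {v \<in> borel_measurable borel. (\<integral>\<^sup>+x. complementary \<Phi> (cmod (v x)) \<partial>m) \<le> 1}"
    using E by simp
  then have "(\<integral>\<^sup>+x. ennreal (cmod (indicator E x * ?v x)) \<partial>m) \<le> orlicz_norm \<Phi> m (indicator E)"
    unfolding orlicz_norm_def by (rule SUP_upper)
  moreover have "(\<integral>\<^sup>+x. ennreal (cmod (indicator E x * ?v x)) \<partial>m) = (\<integral>\<^sup>+x. ennreal y * indicator E x \<partial>m)"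
    using y by (intro nn_integral_cong) (auto simp: indicator_def)
  moreover have "\<dots> = ennreal (y * k)"
    using E s y k by (simp add: nn_integral_cmult_indicator ennreal_mult)
  moreover have "0 < ennreal (y * k)" using y k by simp
  ultimately show ?thesis by (metis order.strict_trans2)
qed

section \<open>Dense orbits approach a multiple of an indicator at arbitrarily late times\<close>

lemma scaled_indicator_in_orlicz_space:
  assumes s: "sets m = sets borel" and inc: "increasing_complementary \<Phi>" and "\<Phi> 0 = 0"
    and E: "E \<in> sets borel" "emeasure m E < \<infinity>" and "0 < c"
  shows "(\<lambda>x. complex_of_real c * indicator E x) \<in> orlicz_space \<Phi> m"
proof -
  obtain x where x: "0 < x" "\<Phi> x < \<infinity>"
    using increasing_complementary_finite_value[OF inc \<open>\<Phi> 0 = 0\<close>] by blast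
  have "(\<integral>\<^sup>+y. \<Phi> (x / c * cmod (complex_of_real c * indicator E y)) \<partial>m) = (\<integral>\<^sup>+y. \<Phi> x * indicator E y \<partial>m)"
    using \<open>0 < c\<close> assms(3) by (intro nn_integral_cong) (auto simp: indicator_def)
  also have "\<dots> < \<infinity>"
    using E s x by (simp add: nn_integral_cmult_indicator ennreal_mult_less_top)
  finally show ?thesis
    using E x \<open>0 < c\<close> by (auto simp: orlicz_space_def intro!: exI[of _ "x / c"])
qed

text \<open>Density gives one orbit point near \<open>u\<close>, but \<open>n\<close> might be small. A fixed orbit point is at distance
  \<open>0\<close> from at most one multiple \<open>(1 + t) u\<close>, so for some small \<open>t\<close> all of the first orbit points stay
  away from \<open>(1 + t) u\<close>.\<close>

lemma orlicz_dense_orbit_recurrent: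
  fixes L :: "nat \<Rightarrow> 'a::topological_space \<Rightarrow> complex"
  assumes s: "sets m = sets borel"
    and dense: "orlicz_dense \<Phi> m (insert f {L n | n. n \<ge> 1})"
    and u: "u \<in> borel_measurable borel" "orlicz_norm \<Phi> m u > 0" "orlicz_norm \<Phi> m u < \<infinity>"
    and scaled: "\<And>c::real. 0 < c \<Longrightarrow> (\<lambda>x. complex_of_real c * u x) \<in> orlicz_space \<Phi> m"
    and "0 < \<epsilon>"
  obtains n where "n > N" "orlicz_norm \<Phi> m (\<lambda>x. L n x - u x) < ennreal \<epsilon>"
proof -
  let ?D = "insert f {L n | n. n \<ge> 1}" and ?G = "insert f (L ` {1..N})"
  let ?d = "\<lambda>g t. orlicz_norm \<Phi> m (\<lambda>x. g x - complex_of_real (1 + t) * u x)"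
  have D: "g \<in> borel_measurable borel" if "g \<in> ?D" for g
    using dense that by (auto simp: orlicz_dense_def orlicz_space_def)
  have GD: "?G \<subseteq> ?D" by auto
  have cu: "(\<lambda>x. complex_of_real c * u x) \<in> borel_measurable borel" for c using u(1) by simp
  obtain K where K: "orlicz_norm \<Phi> m u = ennreal K" "0 < K"
    using u(2,3) by (cases "orlicz_norm \<Phi> m u") auto
  have "finite {t. ?d g t = 0}" if g: "g \<in> ?G" for g
  proof -
    have "t = t'" if "?d g t = 0" "?d g t' = 0" for t t'
    proof -
      have "orlicz_norm \<Phi> m (\<lambda>x. complex_of_real (1 + t) * u x - complex_of_real (1 + t') * u x) \<le> 0"
        using orlicz_norm_triangle[OF s cu[of "1 + t"] D cu[of "1 + t'"], of g \<Phi>] g GD that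
          orlicz_norm_diff_commute[of \<Phi> m "\<lambda>x. complex_of_real (1 + t) * u x" g] by auto
      also have "(\<lambda>x. complex_of_real (1 + t) * u x - complex_of_real (1 + t') * u x) =
          (\<lambda>x. complex_of_real (t - t') * u x)"
        by (auto simp: algebra_simps)
      finally have "ennreal \<bar>t - t'\<bar> * ennreal K = 0"
        unfolding orlicz_norm_cmult[OF s u(1)] K(1) by (simp del: of_real_diff)
      then show "t = t'" using K(2) by simp
    qed
    then have "{t. ?d g t = 0} \<subseteq> {t}" if "?d g t = 0" for t using that by blast
    then show ?thesis by (cases "{t. ?d g t = 0} = {}") (auto intro: finite_subset)
  qed
  then have fin: "finite (\<Union>g\<in>?G. {t. ?d g t = 0})" by blast
  \<comment> \<open>Below \<open>\<epsilon> / (2 * K)\<close> the vectors \<open>(1 + t) u\<close>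
    and \<open>u\<close> differ by less than \<open>\<epsilon> / 2\<close> in norm; removing the
    finitely many bad values of \<open>t\<close> leaves such a \<open>t\<close>.\<close>
  have "infinite {0<..<\<epsilon> / (2 * K)}" using \<open>0 < \<epsilon>\<close> K(2) by (intro infinite_Ioo) simp
  then have "infinite ({0<..<\<epsilon> / (2 * K)} - (\<Union>g\<in>?G. {t. ?d g t = 0}))"
    by (rule Diff_infinite_finite[OF fin])
  then obtain t where "t \<in> {0<..<\<epsilon> / (2 * K)} - (\<Union>g\<in>?G. {t. ?d g t = 0})"
    using infinite_imp_nonempty by blast
  then have t: "0 < t" "t < \<epsilon> / (2 * K)" "\<And>g. g \<in> ?G \<Longrightarrow> ?d g t \<noteq> 0"
    by auto
  \<comment> \<open>No larger than the distance from \<open>(1 + t) u\<close> to any of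
    \<open>f\<close>, \<open>L 1\<close>, ..., \<open>L N\<close>, so an approximant closer than
    \<open>r\<close> must be a later orbit point.\<close>
  define r where "r = min (ennreal (\<epsilon> / 2)) (Min ((\<lambda>g. ?d g t) ` ?G))"
  have "0 < Min ((\<lambda>g. ?d g t) ` ?G)"
    using t(3) by (subst Min_gr_iff) (auto simp: zero_less_iff_neq_zero)
  then have "0 < r" using \<open>0 < \<epsilon>\<close> by (simp add: r_def)
  have "(\<lambda>x. complex_of_real (1 + t) * u x) \<in> orlicz_space \<Phi> m"
    using t(1) by (intro scaled) simp
  with dense have "\<forall>\<epsilon>>0. \<exists>h\<in>?D. ?d h t < \<epsilon>"
    unfolding orlicz_dense_def by (elim conjE) (erule (1) bspec)
  with \<open>0 < r\<close> obtain h where h: "h \<in> ?D" "?d h t < r" by blast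
  have "h \<notin> ?G"
  proof
    assume "h \<in> ?G"
    then have "Min ((\<lambda>g. ?d g t) ` ?G) \<le> ?d h t" by (intro Min_le) auto
    then have "r \<le> ?d h t" unfolding r_def by (rule min.coboundedI2)
    with h(2) show False by simp
  qed
  then obtain n where n: "h = L n" "n > N"
    using h(1) by (auto simp: image_iff)
  have "orlicz_norm \<Phi> m (\<lambda>x. h x - u x) \<le> ?d h t +
      orlicz_norm \<Phi> m (\<lambda>x. complex_of_real (1 + t) * u x - u x)"
    by (rule orlicz_norm_triangle[OF s D[OF h(1)] cu u(1)])
  also have "(\<lambda>x. complex_of_real (1 + t) * u x - u x) = (\<lambda>x. complex_of_real t * u x)"
    by (auto simp: algebra_simps)
  also have "orlicz_norm \<Phi> m \<dots> = ennreal (t * K)"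
    using t(1) K(2) by (simp add: orlicz_norm_cmult[OF s u(1)] K(1) ennreal_mult)
  also have "?d h t + ennreal (t * K) < ennreal (\<epsilon> / 2) + ennreal (\<epsilon> / 2)"
  proof (rule add_strict_mono)
    show "?d h t < ennreal (\<epsilon> / 2)" using h(2) by (simp add: r_def)
    show "ennreal (t * K) < ennreal (\<epsilon> / 2)"
      using t K(2) \<open>0 < \<epsilon>\<close> by (intro ennreal_lessI) (auto simp: field_simps)
  qed
  also have "\<dots> = ennreal \<epsilon>" using \<open>0 < \<epsilon>\<close> by (simp add: ennreal_plus[symmetric] del: ennreal_plus)
  finally show thesis using that n by simp
qed

section \<open>Hypercyclicity\<close>

context hypergroup
begin

lemma orlicz_norm_vimage_hg_mult_le:
  assumes haar: "right_haar_measure conv m" and z: "z \<in> hg_center conv invol e"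
    and mono: "mono_on {0..} (complementary \<Phi>)" and A: "A \<in> sets borel"
  shows "orlicz_norm \<Phi> m (indicator ((\<lambda>x. hg_mult conv x z) -` A)) \<le> orlicz_norm \<Phi> m (indicator A)"
proof -
  have s: "sets m = sets borel"
    using haar by (intro radon_measure_sets) (simp add: right_haar_measure_def)
  note z' = invol_center[OF z]
  have "orlicz_norm \<Phi> m (\<lambda>x. indicator A (hg_mult conv x z)) \<le> orlicz_norm \<Phi> m (indicator A)"
    by (rule orlicz_norm_compose_le[OF s mono measurable_hg_mult[OF z] distr_haar_hg_mult[OF haar z]
          measurable_hg_mult[OF z'] distr_haar_hg_mult[OF haar z']])
       (use A hg_mult_invol[OF z] in auto)
  moreover have "(\<lambda>x. indicator A (hg_mult conv x z) :: complex) = indicator ((\<lambda>x. hg_mult conv x z) -` A)"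
    by (auto simp: indicator_def fun_eq_iff)
  ultimately show ?thesis by simp
qed

lemma Lambda_center:
  assumes a: "range a \<subseteq> hg_center conv invol e" "\<And>n::nat. a (- int n) = invol (a (int n))"
    and w: "w \<in> borel_measurable borel" and f: "f \<in> borel_measurable borel"
  shows "Lambda conv w a n f x =
    complex_of_real (weight_prod conv invol w a n x) * f (hg_mult conv x (invol (a (int n))))"
proof -
  have z: "invol (a (int j)) \<in> hg_center conv invol e" for j
    using a(1) by (intro invol_center) auto
  show ?thesis
    by (simp add: Lambda_def weight_prod_def a(2) hg_eval_center[OF z w] hg_eval_center[OF z f])
qed

text \<open>One term of the sequences, at precision \<open>\<epsilon>\<close> and past the index
  \<open>N\<close>. The factor 4 counts the exceptional sets removed from \<open>E\<close>; the
  factor 2 comes from values within \<open>\<epsilon> \<le> 1 / 2\<close> of 1, whose modulus is at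
  least \<open>1 / 2\<close>.\<close>

lemma hypercyclic_approximation_step:
  assumes young: "young_function \<Phi>" and inc: "increasing_complementary \<Phi>"
    and haar: "right_haar_measure conv m" and weight: "hg_weight w"
    and aper: "aperiodic conv invol e m a" and center: "range a \<subseteq> hg_center conv invol e"
    and hyper: "densely_hypercyclic_weight conv m a \<Phi> w"
    and E: "compact E" "emeasure m E > 0" and \<epsilon>: "0 < \<epsilon>" "\<epsilon> \<le> 1 / 2"
  shows "\<exists>n F. n > N \<and> F \<in> sets borel \<and> F \<subseteq> E \<and>
    orlicz_norm \<Phi> m (indicator (E - F)) \<le> ennreal (4 * \<epsilon>) \<and>
    (\<forall>x\<in>F. \<bar>1 / weight_prod conv invol w a n x\<bar> \<le> 2 * \<epsilon>) \<and>
    (\<forall>x\<in>F. \<bar>weight_prod_shift conv invol w a n x\<bar> \<le> 2 * \<epsilon>)"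
proof -
  have rad: "radon_measure m" using haar by (simp add: right_haar_measure_def)
  have s: "sets m = sets borel" by (rule radon_measure_sets[OF rad])
  have Eb: "E \<in> sets borel" using E(1) by (rule borel_compact)
  have Efin: "emeasure m E < \<infinity>" by (rule radon_measure_compact_finite[OF rad E(1)])
  have mono: "mono_on {0..} (complementary \<Phi>)" using inc by (simp add: increasing_complementary_def)
  have \<Phi>0: "\<Phi> 0 = 0" using young by (simp add: young_function_def)
  have inv: "a (- int n) = invol (a (int n))" for n :: nat
    using aper by (simp add: aperiodic_def)
  obtain N0 where N0: "\<And>n::nat. n \<ge> N0 \<Longrightarrow> E \<inter> hg_set_mult conv E {a (int n)} = {} \<and>
      E \<inter> hg_set_mult conv E {a (- int n)} = {}"
    using aper E unfolding aperiodic_def by blast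
  have wb: "w \<in> borel_measurable borel"
    using weight by (auto simp: hg_weight_def intro: borel_measurable_continuous_onI)
  have \<epsilon>2: "0 < \<epsilon> * \<epsilon>" using \<epsilon> by simp
  let ?I = "indicator E :: 'a \<Rightarrow> complex"
  have scaled: "(\<lambda>x. complex_of_real c * ?I x) \<in> orlicz_space \<Phi> m" if "0 < c" for c
    by (rule scaled_indicator_in_orlicz_space[OF s inc \<Phi>0 Eb Efin that])
  have I: "?I \<in> orlicz_space \<Phi> m" using scaled[of 1] by simp
  have "orlicz_dense \<Phi> m {f. hypercyclic_vector conv m a \<Phi> w f}"
    using hyper by (simp add: densely_hypercyclic_weight_def)
  with I have "\<forall>\<epsilon>>0. \<exists>f\<in>{f. hypercyclic_vector conv m a \<Phi> w f}. orlicz_norm \<Phi> m (\<lambda>x. f x - ?I x) < \<epsilon>"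
    unfolding orlicz_dense_def by (elim conjE) (erule (1) bspec)
  \<comment> \<open>Distance \<open>\<epsilon> * \<epsilon>\<close> is requested because the
    Chebyshev bound divides it by the level \<open>\<epsilon>\<close>.\<close>
  moreover have "ennreal (\<epsilon> * \<epsilon>) > 0" using \<epsilon>2 by simp
  ultimately obtain f where f: "hypercyclic_vector conv m a \<Phi> w f"
      "orlicz_norm \<Phi> m (\<lambda>x. f x - ?I x) < ennreal (\<epsilon> * \<epsilon>)"
    by blast
  have dense: "orlicz_dense \<Phi> m (insert f {Lambda conv w a n f | n. n \<ge> 1})"
    and fb: "f \<in> borel_measurable borel"
    using f(1) by (auto simp: hypercyclic_vector_def orlicz_space_def)
  have Ib: "?I \<in> borel_measurable borel" using Eb by simp
  \<comment> \<open>Exceeding \<open>N\<close> keeps the indices increasing; exceeding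
    \<open>N0\<close> makes both translates of \<open>E\<close> disjoint from
    \<open>E\<close>.\<close>
  obtain n where n: "n > max N N0" "orlicz_norm \<Phi> m (\<lambda>x. Lambda conv w a n f x - ?I x) < ennreal (\<epsilon> * \<epsilon>)"
    by (rule orlicz_dense_orbit_recurrent[OF s dense Ib orlicz_norm_indicator_pos[OF s young Eb Efin E(2)]
          orlicz_norm_indicator_finite[OF s inc \<Phi>0 Eb Efin] scaled \<epsilon>2])
  let ?L = "Lambda conv w a n f"
  have "insert f {Lambda conv w a n f | n. n \<ge> 1} \<subseteq> orlicz_space \<Phi> m"
    using dense unfolding orlicz_dense_def by (rule conjunct1)
  moreover have "n \<ge> 1" using n(1) by simp
  ultimately have "?L \<in> orlicz_space \<Phi> m" by blast
  then have Lb: "?L \<in> borel_measurable borel" by (simp add: orlicz_space_def)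
  have z: "a (int n) \<in> hg_center conv invol e" using center by auto
  note z' = invol_center[OF z]
  let ?T = "\<lambda>x. hg_mult conv x (a (int n))" and ?S = "\<lambda>x. hg_mult conv x (invol (a (int n)))"
  let ?v = "weight_prod conv invol w a n"
  have L: "?L x = complex_of_real (?v x) * f (?S x)" for x
    by (rule Lambda_center[OF center inv wb fb])
  have vpos: "0 < ?v x" for x
    using weight by (simp add: weight_prod_def hg_weight_def prod_pos)
  have notE: "?T x \<notin> E" "?S x \<notin> E" if "x \<in> E" for x
    using N0[of n] n(1) that
    by (auto simp: hg_set_mult_def inv supp_conv_center[OF z] supp_conv_center[OF z'])
  define P where "P = {x. \<epsilon> \<le> cmod (f x - ?I x)}"
  define Q where "Q = {x. \<epsilon> \<le> cmod (?L x - ?I x)}"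
  have Pb: "P \<in> sets borel" and Qb: "Q \<in> sets borel"
    unfolding P_def Q_def using fb Lb Ib
    by (auto intro!: borel_measurable_le simp: pred_def[symmetric])
  have P: "orlicz_norm \<Phi> m (indicator P) \<le> ennreal \<epsilon>"
    by (rule orlicz_norm_indicator_level[OF s Pb \<epsilon>(1) _ less_imp_le[OF f(2)]]) (simp add: P_def)
  have Q: "orlicz_norm \<Phi> m (indicator Q) \<le> ennreal \<epsilon>"
    by (rule orlicz_norm_indicator_level[OF s Qb \<epsilon>(1) _ less_imp_le[OF n(2)]]) (simp add: Q_def)
  have SP: "orlicz_norm \<Phi> m (indicator (?S -` P)) \<le> ennreal \<epsilon>"
    using orlicz_norm_vimage_hg_mult_le[OF haar z' mono Pb] P by (rule order_trans)
  have TQ: "orlicz_norm \<Phi> m (indicator (?T -` Q)) \<le> ennreal \<epsilon>"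
    using orlicz_norm_vimage_hg_mult_le[OF haar z mono Qb] Q by (rule order_trans)
  have SPb: "?S -` P \<in> sets borel" and TQb: "?T -` Q \<in> sets borel"
    by (rule vimage_hg_mult_borel[OF z' Pb], rule vimage_hg_mult_borel[OF z Qb])
  \<comment> \<open>On \<open>F\<close> the values \<open>f x\<close> and \<open>?L x\<close> are
    near 1. Removing the two preimages keeps \<open>f\<close> near 0 at \<open>?S x\<close> and
    \<open>?L\<close> near 0 at \<open>?T x\<close>, since those points lie outside
    \<open>E\<close>.\<close>
  define F where "F = E - (P \<union> Q \<union> ?S -` P \<union> ?T -` Q)"
  have Fb: "F \<in> sets borel" using Eb Pb Qb SPb TQb by (simp add: F_def)
  have bound: "orlicz_norm \<Phi> m (indicator (E - F)) \<le> ennreal (4 * \<epsilon>)"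
  proof -
    let ?i = "\<lambda>A x. indicator A x :: complex"
    have "orlicz_norm \<Phi> m (indicator (E - F)) \<le>
        orlicz_norm \<Phi> m (\<lambda>x. ?i P x + (?i Q x + (?i (?S -` P) x + ?i (?T -` Q) x)))"
      by (rule orlicz_norm_mono) (auto simp: F_def indicator_def)
    also have "\<dots> \<le> orlicz_norm \<Phi> m (?i P) + orlicz_norm \<Phi> m (\<lambda>x. ?i Q x + (?i (?S -` P) x + ?i (?T -` Q) x))"
      using Pb Qb SPb TQb by (intro orlicz_norm_add_le[OF s]) auto
    also have "\<dots> \<le> orlicz_norm \<Phi> m (?i P) +
        (orlicz_norm \<Phi> m (?i Q) + orlicz_norm \<Phi> m (\<lambda>x. ?i (?S -` P) x + ?i (?T -` Q) x))"
      using Pb Qb SPb TQb by (intro add_left_mono orlicz_norm_add_le[OF s]) auto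
    also have "\<dots> \<le> orlicz_norm \<Phi> m (?i P) +
        (orlicz_norm \<Phi> m (?i Q) + (orlicz_norm \<Phi> m (?i (?S -` P)) + orlicz_norm \<Phi> m (?i (?T -` Q))))"
      using SPb TQb by (intro add_left_mono orlicz_norm_add_le[OF s]) auto
    also have "\<dots> \<le> ennreal \<epsilon> + (ennreal \<epsilon> + (ennreal \<epsilon> + ennreal \<epsilon>))"
      by (intro add_mono P Q SP TQ)
    also have "\<dots> = ennreal (4 * \<epsilon>)"
      using \<epsilon>(1) by (simp add: ennreal_plus[symmetric] del: ennreal_plus)
    finally show ?thesis .
  qed
  have pointwise: "1 / ?v x \<le> 2 * \<epsilon>" "?v (?T x) \<le> 2 * \<epsilon>" if "x \<in> F" for x
  proof -
    have x: "x \<in> E" "x \<notin> P" "x \<notin> Q" "?S x \<notin> P" "?T x \<notin> Q" using that by (auto simp: F_def)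
    have fx: "1 / 2 \<le> cmod (f x)"
      using x(1,2) \<epsilon>(2) norm_triangle_ineq2[of 1 "f x"] by (simp add: P_def norm_minus_commute)
    have fS: "cmod (f (?S x)) < \<epsilon>"
      using x(4) notE(2)[OF x(1)] by (simp add: P_def)
    have "cmod (complex_of_real (?v x) * f (?S x) - 1) < \<epsilon>"
      using x(1,3) by (simp add: Q_def L)
    then have "1 / 2 \<le> cmod (complex_of_real (?v x) * f (?S x))"
      using \<epsilon>(2) norm_triangle_ineq2[of 1 "complex_of_real (?v x) * f (?S x)"]
      by (simp add: norm_minus_commute)
    also have "\<dots> = ?v x * cmod (f (?S x))" using vpos[of x] by (simp add: norm_mult)
    also have "\<dots> \<le> ?v x * \<epsilon>" using fS vpos[of x] by (intro mult_left_mono) auto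
    finally show "1 / ?v x \<le> 2 * \<epsilon>" using vpos[of x] by (simp add: field_simps)
    \<comment> \<open>Since \<open>?S\<close> undoes \<open>?T\<close>, evaluating \<open>?L\<close>
      at \<open>?T x\<close> brings back the value of \<open>f\<close> at \<open>x\<close>
      itself.\<close>
    have "cmod (complex_of_real (?v (?T x)) * f x) < \<epsilon>"
      using x(5) notE(1)[OF x(1)] by (simp add: Q_def L hg_mult_invol[OF z])
    then have "?v (?T x) * cmod (f x) < \<epsilon>" using vpos[of "?T x"] by (simp add: norm_mult)
    moreover have "?v (?T x) * (1 / 2) \<le> ?v (?T x) * cmod (f x)"
      using fx vpos[of "?T x"] by (intro mult_left_mono) auto
    ultimately show "?v (?T x) \<le> 2 * \<epsilon>" by simp
  qed
  have "\<forall>x\<in>F. \<bar>1 / ?v x\<bar> \<le> 2 * \<epsilon>" "\<forall>x\<in>F. \<bar>weight_prod_shift conv invol w a n x\<bar> \<le> 2 * \<epsilon>"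
    using pointwise vpos by (auto simp: weight_prod_shift_def abs_of_pos)
  moreover have "n > N" "F \<subseteq> E" using n(1) by (auto simp: F_def)
  ultimately show ?thesis using Fb bound by blast
qed

end

section \<open>Assembling the sequences and their limits\<close>

lemma sup_norm_on_leI:
  assumes "\<And>x. x \<in> A \<Longrightarrow> \<bar>g x\<bar> \<le> c"
  shows "sup_norm_on A g \<le> ennreal c"
  unfolding sup_norm_on_def by (intro SUP_least ennreal_leI assms)

lemma tendsto_zero_ennreal_bound:
  fixes f :: "nat \<Rightarrow> ennreal" and b :: "nat \<Rightarrow> real"
  assumes "\<And>k. f k \<le> ennreal (b k)" and "b \<longlonglongrightarrow> 0"
  shows "f \<longlonglongrightarrow> 0"
proof (rule tendsto_sandwich)
  show "(\<lambda>_. 0) \<longlonglongrightarrow> (0::ennreal)" by simp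
  show "(\<lambda>k. ennreal (b k)) \<longlonglongrightarrow> 0" using tendsto_ennrealI[OF assms(2)] by simp
qed (use assms(1) in auto)

theorem theorem2p20:
  fixes conv :: "('a::t2_space set \<Rightarrow> complex) \<Rightarrow> ('a set \<Rightarrow> complex) \<Rightarrow> 'a set \<Rightarrow> complex"
    and invol :: "'a \<Rightarrow> 'a" and e :: 'a and m :: "'a measure"
    and \<Phi> :: "real \<Rightarrow> ennreal" and w :: "'a \<Rightarrow> real" and a :: "int \<Rightarrow> 'a" and E :: "'a set"
  assumes "young_function \<Phi>" and "increasing_complementary \<Phi>"
    and "hypergroup conv invol e" and "right_haar_measure conv m"
    and "hg_weight w"
    and "aperiodic conv invol e m a" and "range a \<subseteq> hg_center conv invol e"
    and "densely_hypercyclic_weight conv m a \<Phi> w"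
    and "compact E" and "emeasure m E > 0"
  shows "\<exists>(F :: nat \<Rightarrow> 'a set) (n :: nat \<Rightarrow> nat).
           (\<forall>k. F k \<in> sets borel \<and> F k \<subseteq> E) \<and>
           strict_mono n \<and> (\<forall>k. n k \<ge> 1) \<and>
           (\<lambda>k. orlicz_norm \<Phi> m (indicator (E - F k))) \<longlonglongrightarrow> 0 \<and>
           (\<lambda>k. sup_norm_on (F k) (\<lambda>x. 1 / weight_prod conv invol w a (n k) x)) \<longlonglongrightarrow> 0 \<and>
           (\<lambda>k. sup_norm_on (F k) (weight_prod_shift conv invol w a (n k))) \<longlonglongrightarrow> 0"
proof -
  interpret hypergroup conv invol e by fact
  \<comment> \<open>The shift by 2 makes \<open>\<epsilon> k \<le> 1 / 2\<close> already at
    \<open>k = 0\<close>.\<close>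
  define \<epsilon> :: "nat \<Rightarrow> real" where "\<epsilon> k = 1 / real (k + 2)" for k
  let ?P = "\<lambda>k n F. F \<in> sets borel \<and> F \<subseteq> E \<and>
    orlicz_norm \<Phi> m (indicator (E - F)) \<le> ennreal (4 * \<epsilon> k) \<and>
    (\<forall>x\<in>F. \<bar>1 / weight_prod conv invol w a n x\<bar> \<le> 2 * \<epsilon> k) \<and>
    (\<forall>x\<in>F. \<bar>weight_prod_shift conv invol w a n x\<bar> \<le> 2 * \<epsilon> k)"
  have step: "\<exists>n F. n > N \<and> ?P k n F" for k N
    by (rule hypercyclic_approximation_step[OF assms(1,2,4-10)]) (auto simp: \<epsilon>_def)
  \<comment> \<open>Dependent choice of pairs of an index and a set: each step is applied with
    \<open>N\<close> equal to the previous index, and the first with \<open>N = 0\<close>, so the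
    indices increase strictly and start at 1 or later.\<close>
  have "\<exists>g. \<forall>k. (fst (g k) \<ge> 1 \<and> ?P k (fst (g k)) (snd (g k))) \<and> fst (g k) < fst (g (Suc k))"
  proof (rule dependent_nat_choice)
    obtain n F where "n > 0" "?P 0 n F" using step[of 0 0] by blast
    then show "\<exists>p. fst p \<ge> 1 \<and> ?P 0 (fst p) (snd p)" by (intro exI[of _ "(n, F)"]) auto
  next
    fix p :: "nat \<times> 'a set" and k
    obtain n F where "n > fst p" "?P (Suc k) n F" using step[of "fst p" "Suc k"] by blast
    then show "\<exists>q. (fst q \<ge> 1 \<and> ?P (Suc k) (fst q) (snd q)) \<and> fst p < fst q"
      by (intro exI[of _ "(n, F)"]) auto
  qed
  then obtain g where g: "\<And>k. fst (g k) \<ge> 1" "\<And>k. ?P k (fst (g k)) (snd (g k))"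
      "\<And>k. fst (g k) < fst (g (Suc k))"
    by blast
  have lim: "\<epsilon> \<longlonglongrightarrow> 0"
    unfolding \<epsilon>_def using LIMSEQ_ignore_initial_segment[OF lim_1_over_n[where 'a=real], of 2] by simp
  have "(\<lambda>k. orlicz_norm \<Phi> m (indicator (E - snd (g k)))) \<longlonglongrightarrow> 0"
    by (rule tendsto_zero_ennreal_bound[of _ "\<lambda>k. 4 * \<epsilon> k"]) (use g(2) tendsto_mult_right_zero[OF lim] in auto)
  moreover have "(\<lambda>k. sup_norm_on (snd (g k)) (\<lambda>x. 1 / weight_prod conv invol w a (fst (g k)) x)) \<longlonglongrightarrow> 0"
    by (rule tendsto_zero_ennreal_bound[of _ "\<lambda>k. 2 * \<epsilon> k"], rule sup_norm_on_leI)
       (use g(2) tendsto_mult_right_zero[OF lim] in auto)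
  moreover have "(\<lambda>k. sup_norm_on (snd (g k)) (weight_prod_shift conv invol w a (fst (g k)))) \<longlonglongrightarrow> 0"
    by (rule tendsto_zero_ennreal_bound[of _ "\<lambda>k. 2 * \<epsilon> k"], rule sup_norm_on_leI)
       (use g(2) tendsto_mult_right_zero[OF lim] in auto)
  moreover have "strict_mono (\<lambda>k. fst (g k))"
    using g(3) by (simp add: strict_mono_Suc_iff)
  moreover have "\<forall>k. snd (g k) \<in> sets borel \<and> snd (g k) \<subseteq> E"
    using g(2) by blast
  moreover have "\<forall>k. fst (g k) \<ge> 1" using g(1) by blast
  ultimately show ?thesis
    by (intro exI[of _ "\<lambda>k. snd (g k)"] exI[of _ "\<lambda>k. fst (g k)"] conjI)
qed

end
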